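(* Let $S$ be a semigroup with finitely many left and right ideals, let $K$ be the unique minimal ideal of $S$, and let $H$ be a maximal subgroup of $S$ in $K$. Then the following are equivalent: (i) $S$ is of type left-$\mathrm{FP}_1$; (ii) $S$ is of type right-$\mathrm{FP}_1$; (iii) the group $H$ is finitely generated (equivalently, $H$ is of type $\mathrm{FP}_1$).
   Context: For a monoid $S$, $\mathbb{Z}S$ denotes the integral monoid ring, and $\mathbb{Z}$ is regarded as the trivial left (respectively right) $\mathbb{Z}S$-module via the augmentation $\epsilon_S:\mathbb{Z}S\to\mathbb{Z}$, $s\mapsto 1$ ($s\in S$). The monoid $S$ is of type left-$\mathrm{FP}_1$ (respectively right-$\mathrm{FP}_1$) if there is an exact sequence $A_1\to A_0\to\mathbb{Z}\to 0$ of left (respectively right) $\mathbb{Z}S$-modules with $A_0,A_1$ finitely generated and free. A semigroup $S$ without a two-sided identity is of type left-$\mathrm{FP}_1$ (right-$\mathrm{FP}_1$) if the monoid $S^1=S\cup\{1\}$, obtained by adjoining an identity element, is. For a group, left-$\mathrm{FP}_1$ and right-$\mathrm{FP}_1$ are equivalent and one says "type $\mathrm{FP}_1$". The minimal ideal is the minimal two-sided ideal. For an idempotent $e\in S$, the maximal subgroup of $S$ containing $e$ is the group of units of $eSe$. *)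

theory Defs
  imports
    "HOL-Algebra.Module"
    "HOL-Algebra.Generated_Groups"
    "HOL-Library.Poly_Mapping"
begin

section \<open>Integral monoid rings\<close>

text \<open>Elements of \<open>\<int>M\<close> are the finitely supported functions with support in \<open>carrier M\<close>;
  the product is the biadditive extension of the product of \<open>M\<close>. (The multiplication that
  \<^theory>\<open>HOL-Library.Poly_Mapping\<close> itself provides requires an additive monoid of exponents.)\<close>

definition monoid_ring :: "('a, 'c) monoid_scheme \<Rightarrow> ('a \<Rightarrow>\<^sub>0 int) ring" where
  "monoid_ring M =
     \<lparr>carrier = {p. Poly_Mapping.keys p \<subseteq> carrier M},
      monoid.mult = (\<lambda>p q. \<Sum>x\<in>Poly_Mapping.keys p. \<Sum>y\<in>Poly_Mapping.keys q.
        Poly_Mapping.single (x \<otimes>\<^bsub>M\<^esub> y) (Poly_Mapping.lookup p x * Poly_Mapping.lookup q y)),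
      one = Poly_Mapping.single \<one>\<^bsub>M\<^esub> 1,
      zero = 0,
      add = (+)\<rparr>"

definition augmentation :: "('a \<Rightarrow>\<^sub>0 int) \<Rightarrow> int" where
  "augmentation p = (\<Sum>x\<in>Poly_Mapping.keys p. Poly_Mapping.lookup p x)"

section \<open>Modules over noncommutative rings\<close>

text \<open>The locale \<^locale>\<open>module\<close> assumes a commutative ring. As there, the fields \<open>mult\<close> and
  \<open>one\<close> of a module record carry no meaning.\<close>

locale left_module = R?: ring + M?: abelian_group M for M (structure) +
  assumes left_smult_closed:
      "\<lbrakk>a \<in> carrier R; x \<in> carrier M\<rbrakk> \<Longrightarrow> a \<odot>\<^bsub>M\<^esub> x \<in> carrier M"
    and left_smult_l_distr:
      "\<lbrakk>a \<in> carrier R; b \<in> carrier R; x \<in> carrier M\<rbrakk> \<Longrightarrow>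
        (a \<oplus>\<^bsub>R\<^esub> b) \<odot>\<^bsub>M\<^esub> x = a \<odot>\<^bsub>M\<^esub> x \<oplus>\<^bsub>M\<^esub> b \<odot>\<^bsub>M\<^esub> x"
    and left_smult_r_distr:
      "\<lbrakk>a \<in> carrier R; x \<in> carrier M; y \<in> carrier M\<rbrakk> \<Longrightarrow>
        a \<odot>\<^bsub>M\<^esub> (x \<oplus>\<^bsub>M\<^esub> y) = a \<odot>\<^bsub>M\<^esub> x \<oplus>\<^bsub>M\<^esub> a \<odot>\<^bsub>M\<^esub> y"
    and left_smult_assoc:
      "\<lbrakk>a \<in> carrier R; b \<in> carrier R; x \<in> carrier M\<rbrakk> \<Longrightarrow>
        (a \<otimes>\<^bsub>R\<^esub> b) \<odot>\<^bsub>M\<^esub> x = a \<odot>\<^bsub>M\<^esub> (b \<odot>\<^bsub>M\<^esub> x)"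
    and left_smult_one:
      "x \<in> carrier M \<Longrightarrow> \<one>\<^bsub>R\<^esub> \<odot>\<^bsub>M\<^esub> x = x"

text \<open>In a right module, \<open>a \<odot>\<^bsub>M\<^esub> x\<close> stands for the right action \<open>x \<cdot> a\<close>, so the associativity
  law reads \<open>x \<cdot> (a b) = (x \<cdot> a) \<cdot> b\<close>.\<close>

locale right_module = R?: ring + M?: abelian_group M for M (structure) +
  assumes right_smult_closed:
      "\<lbrakk>a \<in> carrier R; x \<in> carrier M\<rbrakk> \<Longrightarrow> a \<odot>\<^bsub>M\<^esub> x \<in> carrier M"
    and right_smult_l_distr:
      "\<lbrakk>a \<in> carrier R; b \<in> carrier R; x \<in> carrier M\<rbrakk> \<Longrightarrow>
        (a \<oplus>\<^bsub>R\<^esub> b) \<odot>\<^bsub>M\<^esub> x = a \<odot>\<^bsub>M\<^esub> x \<oplus>\<^bsub>M\<^esub> b \<odot>\<^bsub>M\<^esub> x"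
    and right_smult_r_distr:
      "\<lbrakk>a \<in> carrier R; x \<in> carrier M; y \<in> carrier M\<rbrakk> \<Longrightarrow>
        a \<odot>\<^bsub>M\<^esub> (x \<oplus>\<^bsub>M\<^esub> y) = a \<odot>\<^bsub>M\<^esub> x \<oplus>\<^bsub>M\<^esub> a \<odot>\<^bsub>M\<^esub> y"
    and right_smult_assoc:
      "\<lbrakk>a \<in> carrier R; b \<in> carrier R; x \<in> carrier M\<rbrakk> \<Longrightarrow>
        (a \<otimes>\<^bsub>R\<^esub> b) \<odot>\<^bsub>M\<^esub> x = b \<odot>\<^bsub>M\<^esub> (a \<odot>\<^bsub>M\<^esub> x)"
    and right_smult_one:
      "x \<in> carrier M \<Longrightarrow> \<one>\<^bsub>R\<^esub> \<odot>\<^bsub>M\<^esub> x = x"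

text \<open>The notions below apply to left and to right modules alike.\<close>

definition module_homs ::
  "('r, 'c) ring_scheme \<Rightarrow> ('r, 'm, 'd) module_scheme \<Rightarrow> ('r, 'n, 'e) module_scheme \<Rightarrow> ('m \<Rightarrow> 'n) set"
  where "module_homs R M N =
    {h \<in> hom (add_monoid M) (add_monoid N).
      \<forall>a\<in>carrier R. \<forall>x\<in>carrier M. h (a \<odot>\<^bsub>M\<^esub> x) = a \<odot>\<^bsub>N\<^esub> h x}"

definition module_basis ::
  "('r, 'c) ring_scheme \<Rightarrow> ('r, 'm, 'd) module_scheme \<Rightarrow> 'm set \<Rightarrow> bool" where
  "module_basis R M B \<longleftrightarrow> finite B \<and> B \<subseteq> carrier M \<and>
     (\<forall>x\<in>carrier M. \<exists>!c. c \<in> B \<rightarrow>\<^sub>E carrier R \<and> x = (\<Oplus>\<^bsub>M\<^esub>b\<in>B. c b \<odot>\<^bsub>M\<^esub> b))"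

definition fin_gen_free ::
  "('r, 'c) ring_scheme \<Rightarrow> ('r, 'm, 'd) module_scheme \<Rightarrow> bool" where
  "fin_gen_free R M \<longleftrightarrow> (\<exists>B. module_basis R M B)"

text \<open>Exactness of \<open>A1 \<rightarrow> A0 \<rightarrow> Z \<rightarrow> 0\<close>, with maps \<open>d1\<close> and \<open>d0\<close>.\<close>

definition exact_presentation ::
  "('r, 'c) ring_scheme \<Rightarrow> ('r, 'm, 'd) module_scheme \<Rightarrow> ('r, 'n, 'e) module_scheme
    \<Rightarrow> ('r, 'z, 'f) module_scheme \<Rightarrow> ('m \<Rightarrow> 'n) \<Rightarrow> ('n \<Rightarrow> 'z) \<Rightarrow> bool" where
  "exact_presentation R A1 A0 Z d1 d0 \<longleftrightarrow>
     d1 \<in> module_homs R A1 A0 \<and> d0 \<in> module_homs R A0 Z \<and>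
     d1 ` carrier A1 = {x \<in> carrier A0. d0 x = \<zero>\<^bsub>Z\<^esub>} \<and>
     d0 ` carrier A0 = carrier Z"

section \<open>The finiteness property FP1\<close>

definition trivial_module :: "('a \<Rightarrow>\<^sub>0 int, int) module" where
  "trivial_module =
     \<lparr>carrier = UNIV, monoid.mult = (*), one = 1, zero = 0, add = (+),
      smult = (\<lambda>p n. augmentation p * n)\<rparr>"

text \<open>Every finitely generated free \<open>\<int>M\<close>-module is isomorphic to some \<open>(\<int>M)\<^sup>n\<close>, hence to one
  whose carrier is a set of functions \<open>nat \<Rightarrow> 'a \<Rightarrow>\<^sub>0 int\<close>. Letting the carriers of \<open>A0\<close> and \<open>A1\<close>
  range over subsets of this type is therefore no restriction.\<close>

definition left_FP1 :: "('a, 'c) monoid_scheme \<Rightarrow> bool" where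
  "left_FP1 M \<longleftrightarrow>
     (\<exists>(A1 :: ('a \<Rightarrow>\<^sub>0 int, nat \<Rightarrow> 'a \<Rightarrow>\<^sub>0 int) module)
       (A0 :: ('a \<Rightarrow>\<^sub>0 int, nat \<Rightarrow> 'a \<Rightarrow>\<^sub>0 int) module) d1 d0.
        left_module (monoid_ring M) A1 \<and> left_module (monoid_ring M) A0 \<and>
        fin_gen_free (monoid_ring M) A1 \<and> fin_gen_free (monoid_ring M) A0 \<and>
        exact_presentation (monoid_ring M) A1 A0 trivial_module d1 d0)"

definition right_FP1 :: "('a, 'c) monoid_scheme \<Rightarrow> bool" where
  "right_FP1 M \<longleftrightarrow>
     (\<exists>(A1 :: ('a \<Rightarrow>\<^sub>0 int, nat \<Rightarrow> 'a \<Rightarrow>\<^sub>0 int) module)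
       (A0 :: ('a \<Rightarrow>\<^sub>0 int, nat \<Rightarrow> 'a \<Rightarrow>\<^sub>0 int) module) d1 d0.
        right_module (monoid_ring M) A1 \<and> right_module (monoid_ring M) A0 \<and>
        fin_gen_free (monoid_ring M) A1 \<and> fin_gen_free (monoid_ring M) A0 \<and>
        exact_presentation (monoid_ring M) A1 A0 trivial_module d1 d0)"

section \<open>Semigroups\<close>

text \<open>The ambient semigroup is a type \<open>'a\<close> of class \<^class>\<open>semigroup_mult\<close>.\<close>

definition is_identity :: "'a::semigroup_mult \<Rightarrow> bool" where
  "is_identity u \<longleftrightarrow> (\<forall>x. u * x = x \<and> x * u = x)"

definition monoid_with_identity :: "'a::semigroup_mult \<Rightarrow> 'a monoid" where
  "monoid_with_identity u = \<lparr>carrier = UNIV, monoid.mult = (*), one = u\<rparr>"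

fun adjoin_mult :: "'a::semigroup_mult option \<Rightarrow> 'a option \<Rightarrow> 'a option" where
  "adjoin_mult None y = y"
| "adjoin_mult (Some x) None = Some x"
| "adjoin_mult (Some x) (Some y) = Some (x * y)"

definition adjoin_identity :: "'a::semigroup_mult itself \<Rightarrow> 'a option monoid" where
  "adjoin_identity _ = \<lparr>carrier = UNIV, monoid.mult = adjoin_mult, one = None\<rparr>"

text \<open>An identity element is adjoined only if the semigroup has none.\<close>

definition semigroup_left_FP1 :: "'a::semigroup_mult itself \<Rightarrow> bool" where
  "semigroup_left_FP1 T \<longleftrightarrow>
     (if \<exists>u::'a. is_identity u
      then left_FP1 (monoid_with_identity (THE u::'a. is_identity u))
      else left_FP1 (adjoin_identity T))"

definition semigroup_right_FP1 :: "'a::semigroup_mult itself \<Rightarrow> bool" where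
  "semigroup_right_FP1 T \<longleftrightarrow>
     (if \<exists>u::'a. is_identity u
      then right_FP1 (monoid_with_identity (THE u::'a. is_identity u))
      else right_FP1 (adjoin_identity T))"

definition left_ideal :: "'a::semigroup_mult set \<Rightarrow> bool" where
  "left_ideal I \<longleftrightarrow> I \<noteq> {} \<and> (\<forall>s. \<forall>x\<in>I. s * x \<in> I)"

definition right_ideal :: "'a::semigroup_mult set \<Rightarrow> bool" where
  "right_ideal I \<longleftrightarrow> I \<noteq> {} \<and> (\<forall>s. \<forall>x\<in>I. x * s \<in> I)"

definition two_sided_ideal :: "'a::semigroup_mult set \<Rightarrow> bool" where
  "two_sided_ideal I \<longleftrightarrow> left_ideal I \<and> right_ideal I"

definition minimal_ideal :: "'a::semigroup_mult set \<Rightarrow> bool" where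
  "minimal_ideal K \<longleftrightarrow> two_sided_ideal K \<and> (\<forall>J. two_sided_ideal J \<and> J \<subseteq> K \<longrightarrow> J = K)"

text \<open>The monoid \<open>eSe\<close> for an idempotent \<open>e\<close>.\<close>

definition local_monoid :: "'a::semigroup_mult \<Rightarrow> 'a monoid" where
  "local_monoid e = \<lparr>carrier = {e * s * e | s. True}, monoid.mult = (*), one = e\<rparr>"

definition maximal_subgroup :: "'a::semigroup_mult monoid \<Rightarrow> bool" where
  "maximal_subgroup H \<longleftrightarrow> (\<exists>e. e * e = e \<and> H = units_of (local_monoid e))"

definition finitely_generated_group :: "('a, 'c) monoid_scheme \<Rightarrow> bool" where
  "finitely_generated_group G \<longleftrightarrow>
     (\<exists>A. finite A \<and> A \<subseteq> carrier G \<and> generate G A = carrier G)"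

end

theory Submission
  imports Defs
begin

text \<open>
  The bridge between homological algebra and semigroups is a graph. For a monoid \<open>M\<close> and
  \<open>A \<subseteq> M\<close>, join \<open>m\<close> to \<open>m a\<close> for all \<open>m \<in> M\<close>, \<open>a \<in> A\<close>. Being of type
  left-FP1 means that the augmentation ideal, which is spanned by the differences \<open>m - 1\<close>, is finitely
  generated as a left ideal of \<open>\<int>M\<close>. The left ideal generated by the \<open>a - 1\<close> with \<open>a \<in> A\<close> is
  spanned by the differences \<open>m a - m\<close> along the edges, so it is the whole augmentation ideal exactly
  if the graph is connected. Hence \<open>M\<close> is of type left-FP1 iff some finite \<open>A\<close> gives a connected
  graph (\<open>left_FP1_iff_finitely_connected\<close>).

  Now let \<open>M\<close> have finitely many principal one-sided ideals and let \<open>e\<close> be an idempotent in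
  its minimal ideal. Then \<open>e M e\<close> is a group (\<open>group_corner\<close>).

  If \<open>e M e\<close> is finitely generated, then some finite \<open>A\<close> gives a connected graph: a vertex \<open>m\<close> is joined to
  \<open>m e\<close>; the generators of \<open>e M e\<close> connect each coset \<open>x (e M e)\<close> with \<open>x \<in> M e\<close>; there
  are only finitely many such cosets, because \<open>x (e M e)\<close> is determined by the right ideal \<open>x M\<close>;
  and edges out of the vertex \<open>1\<close>, labelled by representatives, connect these cosets with each
  other.

  Conversely, suppose that a finite \<open>A\<close> gives a connected graph. The group \<open>e M e\<close> acts on the left
  of \<open>e M\<close>, commuting with the right multiplication by \<open>A\<close>, and with finitely many orbits because
  the orbit of \<open>r\<close> is determined by the left ideal \<open>M r\<close>. As for a group acting freely on a
  connected graph with finite quotient, the labels of the finitely many orbits of edges generate the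
  group. Concretely, if \<open>Q\<close> represents the orbits and \<open>X\<close> is the subgroup generated by all
  \<open>q e\<close> and \<open>q a e\<close>, then the coset \<open>(e m e) X\<close> does not change along edges.

  The right-handed statement is the left-handed one for the opposite monoid, whose group
  \<open>e M e\<close> is the opposite, hence isomorphic, group. The theorem follows by taking for \<open>M\<close> the
  semigroup itself or the semigroup with an identity adjoined, where \<open>e M e\<close> is the maximal subgroup
  at \<open>e\<close>, and by taking for \<open>M\<close> this group with \<open>e = 1\<close>.
\<close>

section \<open>Monoid rings\<close>

lemma monoid_ring_simps [simp]:
  "carrier (monoid_ring M) = {p. Poly_Mapping.keys p \<subseteq> carrier M}"
  "\<one>\<^bsub>monoid_ring M\<^esub> = frag_of \<one>\<^bsub>M\<^esub>"
  "\<zero>\<^bsub>monoid_ring M\<^esub> = 0"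
  "p \<oplus>\<^bsub>monoid_ring M\<^esub> q = p + q"
  by (simp_all add: monoid_ring_def)

text \<open>\<open>\<int>M\<close> is the free abelian group on \<open>M\<close>, and \<^const>\<open>frag_extend\<close> is its universal
  property; in this form the product is visibly biadditive, and identities can be checked on
  \<open>M\<close> with \<open>frag_induction\<close>.\<close>

lemma monoid_ring_mult:
  "p \<otimes>\<^bsub>monoid_ring M\<^esub> q = frag_extend (\<lambda>x. frag_extend (\<lambda>y. frag_of (x \<otimes>\<^bsub>M\<^esub> y)) q) p"
proof -
  have single: "Poly_Mapping.single z (a * b) = frag_cmul a (frag_cmul b (frag_of z))"
    for z :: 'a and a b :: int
    by (rule poly_mapping_eqI) (simp add: lookup_single when_def)
  show ?thesis
    by (simp add: monoid_ring_def frag_extend_def frag_cmul_sum single)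
qed

lemma frag_extend_diff_fun:
  "frag_extend (\<lambda>x. f x - g x) p = frag_extend f p - frag_extend g p"
  using subset_UNIV by (induction p rule: frag_induction) (simp_all add: frag_extend_diff)

lemma monoid_ring_mult_0 [simp]:
  "0 \<otimes>\<^bsub>monoid_ring M\<^esub> q = 0" "p \<otimes>\<^bsub>monoid_ring M\<^esub> 0 = 0"
  by (simp_all add: monoid_ring_mult frag_extend_eq_0)

lemma monoid_ring_mult_frag_of [simp]:
  "frag_of x \<otimes>\<^bsub>monoid_ring M\<^esub> frag_of y = frag_of (x \<otimes>\<^bsub>M\<^esub> y)"
  by (simp add: monoid_ring_mult)

lemma monoid_ring_mult_diff:
  "(p - p') \<otimes>\<^bsub>monoid_ring M\<^esub> q = p \<otimes>\<^bsub>monoid_ring M\<^esub> q - p' \<otimes>\<^bsub>monoid_ring M\<^esub> q"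
  "p \<otimes>\<^bsub>monoid_ring M\<^esub> (q - q') = p \<otimes>\<^bsub>monoid_ring M\<^esub> q - p \<otimes>\<^bsub>monoid_ring M\<^esub> q'"
  by (simp_all add: monoid_ring_mult frag_extend_diff frag_extend_diff_fun)

lemma monoid_ring_mult_add:
  "(p + p') \<otimes>\<^bsub>monoid_ring M\<^esub> q = p \<otimes>\<^bsub>monoid_ring M\<^esub> q + p' \<otimes>\<^bsub>monoid_ring M\<^esub> q"
  "p \<otimes>\<^bsub>monoid_ring M\<^esub> (q + q') = p \<otimes>\<^bsub>monoid_ring M\<^esub> q + p \<otimes>\<^bsub>monoid_ring M\<^esub> q'"
proof -
  have add: "a + b = a - (0 - b)" for a b :: "'a \<Rightarrow>\<^sub>0 int"
    by simp
  show "(p + p') \<otimes>\<^bsub>monoid_ring M\<^esub> q = p \<otimes>\<^bsub>monoid_ring M\<^esub> q + p' \<otimes>\<^bsub>monoid_ring M\<^esub> q"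
    "p \<otimes>\<^bsub>monoid_ring M\<^esub> (q + q') = p \<otimes>\<^bsub>monoid_ring M\<^esub> q + p \<otimes>\<^bsub>monoid_ring M\<^esub> q'"
    by (simp_all only: add monoid_ring_mult_diff monoid_ring_mult_0)
qed

lemma (in monoid) monoid_ring_mult_closed:
  assumes "Poly_Mapping.keys p \<subseteq> carrier G" "Poly_Mapping.keys q \<subseteq> carrier G"
  shows "Poly_Mapping.keys (p \<otimes>\<^bsub>monoid_ring G\<^esub> q) \<subseteq> carrier G"
  unfolding monoid_ring_mult
  using assms by (force dest!: subsetD[OF keys_frag_extend])

lemma (in monoid) monoid_ring_assoc:
  assumes "Poly_Mapping.keys p \<subseteq> carrier G" "Poly_Mapping.keys q \<subseteq> carrier G"
    "Poly_Mapping.keys r \<subseteq> carrier G"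
  shows "p \<otimes>\<^bsub>monoid_ring G\<^esub> q \<otimes>\<^bsub>monoid_ring G\<^esub> r
       = p \<otimes>\<^bsub>monoid_ring G\<^esub> (q \<otimes>\<^bsub>monoid_ring G\<^esub> r)"
  using assms(1)
proof (induction rule: frag_induction)
  case (one x)
  show ?case
    using assms(2)
  proof (induction rule: frag_induction)
    case (one y)
    show ?case
      using assms(3) \<open>x \<in> carrier G\<close> \<open>y \<in> carrier G\<close>
      by (induction rule: frag_induction) (simp_all add: monoid_ring_mult_diff m_assoc)
  qed (simp_all add: monoid_ring_mult_diff)
qed (simp_all add: monoid_ring_mult_diff)

lemma (in monoid) ring_monoid_ring: "ring (monoid_ring G)"
proof (rule ringI)
  show "abelian_group (monoid_ring G)"
  proof (rule abelian_groupI)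
    fix p assume "p \<in> carrier (monoid_ring G)"
    then show "\<exists>q\<in>carrier (monoid_ring G). q \<oplus>\<^bsub>monoid_ring G\<^esub> p = \<zero>\<^bsub>monoid_ring G\<^esub>"
      by (intro bexI[where x = "- p"]) auto
  qed (use keys_add in \<open>force simp: algebra_simps\<close>)+
  have one: "frag_of \<one> \<otimes>\<^bsub>monoid_ring G\<^esub> p = p \<and> p \<otimes>\<^bsub>monoid_ring G\<^esub> frag_of \<one> = p"
    if "Poly_Mapping.keys p \<subseteq> carrier G" for p
    using that by (induction rule: frag_induction) (simp_all add: monoid_ring_mult_diff)
  show "monoid (monoid_ring G)"
    by (rule monoidI)
      (auto simp: one monoid_ring_assoc dest: subsetD[OF monoid_ring_mult_closed])
qed (simp_all add: monoid_ring_mult_add)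

text \<open>If \<open>P\<close> is a union of connected components of a Cayley graph, this functional kills the
  differences along edges and so separates \<open>P\<close> from the other components; for the whole monoid it
  is the augmentation.\<close>

definition coefficient_sum :: "('a \<Rightarrow> bool) \<Rightarrow> ('a \<Rightarrow>\<^sub>0 int) \<Rightarrow> int" where
  "coefficient_sum P p = (\<Sum>x\<in>Poly_Mapping.keys p. if P x then Poly_Mapping.lookup p x else 0)"

lemma coefficient_sum_superset:
  assumes "finite S" "Poly_Mapping.keys p \<subseteq> S"
  shows "coefficient_sum P p = (\<Sum>x\<in>S. if P x then Poly_Mapping.lookup p x else 0)"
  unfolding coefficient_sum_def
  by (rule sum.mono_neutral_left) (use assms in \<open>auto simp: in_keys_iff\<close>)

lemma coefficient_sum_add: "coefficient_sum P (p + q) = coefficient_sum P p + coefficient_sum P q"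
  using keys_add[of p q]
  by (simp add: coefficient_sum_superset[of "Poly_Mapping.keys p \<union> Poly_Mapping.keys q"]
      flip: sum.distrib) (rule sum.cong, simp_all add: Poly_Mapping.lookup_add)

lemma coefficient_sum_0 [simp]: "coefficient_sum P 0 = 0"
  by (simp add: coefficient_sum_def)

lemma coefficient_sum_diff: "coefficient_sum P (p - q) = coefficient_sum P p - coefficient_sum P q"
  using coefficient_sum_add[of P "p - q" q] by simp

lemma coefficient_sum_frag_of [simp]: "coefficient_sum P (frag_of x) = (if P x then 1 else 0)"
  by (simp add: coefficient_sum_def)

lemma augmentation_eq_coefficient_sum: "augmentation p = coefficient_sum (\<lambda>_. True) p"
  by (simp add: augmentation_def coefficient_sum_def)

text \<open>Right multiplication by a monoid element \<open>y\<close> that preserves \<open>P\<close> and its complement moves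
  coefficients around inside each of the two, so \<open>coefficient_sum P\<close> only sees the total weight of
  the right factor.\<close>

lemma coefficient_sum_mult:
  assumes "Poly_Mapping.keys p \<subseteq> carrier M"
    and "\<And>x y. x \<in> carrier M \<Longrightarrow> y \<in> Poly_Mapping.keys q \<Longrightarrow> P (x \<otimes>\<^bsub>M\<^esub> y) \<longleftrightarrow> P x"
  shows "coefficient_sum P (p \<otimes>\<^bsub>monoid_ring M\<^esub> q) = coefficient_sum P p * augmentation q"
  using assms(1)
proof (induction rule: frag_induction)
  case (one x)
  have "coefficient_sum P (frag_of x \<otimes>\<^bsub>monoid_ring M\<^esub> q')
      = coefficient_sum P (frag_of x) * coefficient_sum (\<lambda>_. True) q'"
    if "Poly_Mapping.keys q' \<subseteq> Poly_Mapping.keys q" for q'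
    using that
    by (induction rule: frag_induction)
      (simp_all add: monoid_ring_mult_diff coefficient_sum_diff algebra_simps assms(2) one)
  then show ?case
    by (simp add: augmentation_eq_coefficient_sum)
qed (simp_all add: monoid_ring_mult_diff coefficient_sum_diff algebra_simps)

definition opposite :: "('a, 'c) monoid_scheme \<Rightarrow> 'a monoid" where
  "opposite M = \<lparr>carrier = carrier M, monoid.mult = (\<lambda>x y. y \<otimes>\<^bsub>M\<^esub> x), one = \<one>\<^bsub>M\<^esub>\<rparr>"

lemma opposite_simps [simp]:
  "carrier (opposite M) = carrier M"
  "x \<otimes>\<^bsub>opposite M\<^esub> y = y \<otimes>\<^bsub>M\<^esub> x"
  "\<one>\<^bsub>opposite M\<^esub> = \<one>\<^bsub>M\<^esub>"
  by (simp_all add: opposite_def)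

lemma (in monoid) monoid_opposite: "monoid (opposite G)"
  by (rule monoidI) (simp_all add: m_assoc)

lemma monoid_ring_opposite_mult:
  "p \<otimes>\<^bsub>monoid_ring (opposite M)\<^esub> q = q \<otimes>\<^bsub>monoid_ring M\<^esub> p"
  using subset_UNIV[of "Poly_Mapping.keys p"]
proof (induction p rule: frag_induction)
  case (one x)
  show ?case
    using subset_UNIV[of "Poly_Mapping.keys q"]
    by (induction q rule: frag_induction) (simp_all add: monoid_ring_mult_diff)
qed (simp_all add: monoid_ring_mult_diff)

lemma (in monoid) right_module_iff_left_module_opposite:
  "right_module (monoid_ring G) A \<longleftrightarrow> left_module (monoid_ring (opposite G)) A"
proof -
  have "ring (monoid_ring G)" "ring (monoid_ring (opposite G))"
    using ring_monoid_ring monoid.ring_monoid_ring[OF monoid_opposite] by auto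
  then show ?thesis
    by (auto simp: right_module_def right_module_axioms_def left_module_def left_module_axioms_def
        monoid_ring_opposite_mult)
qed

lemma fin_gen_free_cong:
  assumes "carrier R = carrier R'"
  shows "fin_gen_free R A = fin_gen_free R' A"
  using assms by (simp add: fin_gen_free_def module_basis_def)

lemma exact_presentation_cong:
  assumes "carrier R = carrier R'"
  shows "exact_presentation R A B C f g = exact_presentation R' A B C f g"
  using assms by (simp add: exact_presentation_def module_homs_def)

text \<open>The operations of a right \<open>\<int>M\<close>-module, read as a left action, make it a left module over the
  ring of the opposite monoid. Bases, homomorphisms and exactness refer to the ring only through its
  carrier, which is the same for both monoids.\<close>

lemma (in monoid) right_FP1_iff_left_FP1_opposite: "right_FP1 G \<longleftrightarrow> left_FP1 (opposite G)"
proof -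
  have "carrier (monoid_ring G) = carrier (monoid_ring (opposite G))"
    by simp
  then show ?thesis
    unfolding right_FP1_def left_FP1_def
    by (simp add: right_module_iff_left_module_opposite del: monoid_ring_simps
        cong: fin_gen_free_cong exact_presentation_cong)
qed

section \<open>Homomorphisms out of finitely generated free modules\<close>

lemma (in left_module) left_smult_l_null:
  assumes "x \<in> carrier M" shows "\<zero>\<^bsub>R\<^esub> \<odot>\<^bsub>M\<^esub> x = \<zero>\<^bsub>M\<^esub>"
proof -
  have "\<zero>\<^bsub>R\<^esub> \<odot>\<^bsub>M\<^esub> x \<oplus>\<^bsub>M\<^esub> \<zero>\<^bsub>R\<^esub> \<odot>\<^bsub>M\<^esub> x = \<zero>\<^bsub>R\<^esub> \<odot>\<^bsub>M\<^esub> x"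
    using assms left_smult_l_distr[of "\<zero>\<^bsub>R\<^esub>" "\<zero>\<^bsub>R\<^esub>" x] by simp
  then show ?thesis
    using assms left_smult_closed[of "\<zero>\<^bsub>R\<^esub>" x] by simp
qed

lemma (in left_module) left_smult_finsum:
  assumes "finite B" "a \<in> carrier R" "f \<in> B \<rightarrow> carrier M"
  shows "a \<odot>\<^bsub>M\<^esub> (\<Oplus>\<^bsub>M\<^esub>b\<in>B. f b) = (\<Oplus>\<^bsub>M\<^esub>b\<in>B. a \<odot>\<^bsub>M\<^esub> f b)"
  using assms
proof (induction B)
  case empty
  have "a \<odot>\<^bsub>M\<^esub> \<zero>\<^bsub>M\<^esub> \<oplus>\<^bsub>M\<^esub> a \<odot>\<^bsub>M\<^esub> \<zero>\<^bsub>M\<^esub> = a \<odot>\<^bsub>M\<^esub> \<zero>\<^bsub>M\<^esub>"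
    using empty left_smult_r_distr[of a "\<zero>\<^bsub>M\<^esub>" "\<zero>\<^bsub>M\<^esub>"] by simp
  then show ?case
    using empty left_smult_closed[of a "\<zero>\<^bsub>M\<^esub>"] by simp
next
  case (insert b B)
  then have "f b \<in> carrier M" "f \<in> B \<rightarrow> carrier M" "finsum M f B \<in> carrier M"
    by (auto intro: M.finsum_closed)
  with insert show ?case
    by (simp add: left_smult_r_distr left_smult_closed Pi_def)
qed

definition module_coord :: "('r, 'c) ring_scheme \<Rightarrow> ('r, 'm, 'd) module_scheme \<Rightarrow> 'm set
    \<Rightarrow> 'm \<Rightarrow> 'm \<Rightarrow> 'r" where
  "module_coord R M B x =
     (THE c. c \<in> B \<rightarrow>\<^sub>E carrier R \<and> x = (\<Oplus>\<^bsub>M\<^esub>b\<in>B. c b \<odot>\<^bsub>M\<^esub> b))"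

lemma module_coord:
  assumes "module_basis R M B" "x \<in> carrier M"
  shows "module_coord R M B x \<in> B \<rightarrow>\<^sub>E carrier R"
    and "(\<Oplus>\<^bsub>M\<^esub>b\<in>B. module_coord R M B x b \<odot>\<^bsub>M\<^esub> b) = x"
proof -
  have "\<exists>!c. c \<in> B \<rightarrow>\<^sub>E carrier R \<and> x = (\<Oplus>\<^bsub>M\<^esub>b\<in>B. c b \<odot>\<^bsub>M\<^esub> b)"
    using assms by (simp add: module_basis_def)
  from theI'[OF this] show "module_coord R M B x \<in> B \<rightarrow>\<^sub>E carrier R"
    "(\<Oplus>\<^bsub>M\<^esub>b\<in>B. module_coord R M B x b \<odot>\<^bsub>M\<^esub> b) = x"
    unfolding module_coord_def by auto
qed

lemma (in left_module) module_coord_unique: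
  assumes "module_basis R M B" "c \<in> B \<rightarrow> carrier R" "x = (\<Oplus>\<^bsub>M\<^esub>b\<in>B. c b \<odot>\<^bsub>M\<^esub> b)" "b \<in> B"
  shows "module_coord R M B x b = c b"
proof -
  have B: "B \<subseteq> carrier M"
    using assms(1) by (simp add: module_basis_def)
  have closed: "c b \<odot>\<^bsub>M\<^esub> b \<in> carrier M" if "b \<in> B" for b
    using that assms(2) B by (auto intro!: left_smult_closed)
  then have x: "x \<in> carrier M"
    unfolding assms(3) by (auto intro!: M.finsum_closed)
  have "x = (\<Oplus>\<^bsub>M\<^esub>b\<in>B. restrict c B b \<odot>\<^bsub>M\<^esub> b)"
    unfolding assms(3) by (rule M.finsum_cong') (auto simp: closed)
  moreover have "restrict c B \<in> B \<rightarrow>\<^sub>E carrier R"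
    using assms(2) by auto
  moreover have "\<exists>!c. c \<in> B \<rightarrow>\<^sub>E carrier R \<and> x = (\<Oplus>\<^bsub>M\<^esub>b\<in>B. c b \<odot>\<^bsub>M\<^esub> b)"
    using assms(1) x by (simp add: module_basis_def)
  ultimately have "restrict c B = module_coord R M B x"
    unfolding module_coord_def by (intro the1_equality[symmetric]) simp_all
  then show ?thesis
    using assms(4) by (simp add: fun_eq_iff restrict_def split: if_splits)
qed

lemma module_homsD:
  assumes "f \<in> module_homs R M N"
  shows "x \<in> carrier M \<Longrightarrow> f x \<in> carrier N"
    and "x \<in> carrier M \<Longrightarrow> y \<in> carrier M \<Longrightarrow> f (x \<oplus>\<^bsub>M\<^esub> y) = f x \<oplus>\<^bsub>N\<^esub> f y"
    and "a \<in> carrier R \<Longrightarrow> x \<in> carrier M \<Longrightarrow> f (a \<odot>\<^bsub>M\<^esub> x) = a \<odot>\<^bsub>N\<^esub> f x"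
  using assms by (auto simp: module_homs_def hom_def)

lemma (in left_module) module_hom_zero:
  assumes "left_module R N" "f \<in> module_homs R M N"
  shows "f \<zero>\<^bsub>M\<^esub> = \<zero>\<^bsub>N\<^esub>"
proof -
  interpret N: left_module R N by (rule assms(1))
  have "f (\<zero>\<^bsub>R\<^esub> \<odot>\<^bsub>M\<^esub> \<zero>\<^bsub>M\<^esub>) = \<zero>\<^bsub>R\<^esub> \<odot>\<^bsub>N\<^esub> f \<zero>\<^bsub>M\<^esub>"
    by (rule module_homsD(3)[OF assms(2)]) simp_all
  then show ?thesis
    using module_homsD(1)[OF assms(2), of "\<zero>\<^bsub>M\<^esub>"]
    by (simp add: left_smult_l_null N.left_smult_l_null)
qed

lemma (in left_module) module_basis_induct [consumes 2, case_names zero add]: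
  assumes "module_basis R M B" "x \<in> carrier M"
    and zero: "P \<zero>\<^bsub>M\<^esub>"
    and add: "\<And>a b y. a \<in> carrier R \<Longrightarrow> b \<in> B \<Longrightarrow> y \<in> carrier M \<Longrightarrow> P y
        \<Longrightarrow> P (a \<odot>\<^bsub>M\<^esub> b \<oplus>\<^bsub>M\<^esub> y)"
  shows "P x"
proof -
  have B: "finite B" "B \<subseteq> carrier M"
    using assms(1) by (auto simp: module_basis_def)
  define c where "c = module_coord R M B x"
  have c: "c b \<in> carrier R" if "b \<in> B" for b
    using that module_coord(1)[OF assms(1,2)] unfolding c_def by auto
  have "P (\<Oplus>\<^bsub>M\<^esub>b\<in>C. c b \<odot>\<^bsub>M\<^esub> b)" if "finite C" "C \<subseteq> B" for C
    using that
  proof (induction C)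
    case (insert b C)
    have "\<And>b. b \<in> C \<Longrightarrow> c b \<odot>\<^bsub>M\<^esub> b \<in> carrier M" "c b \<odot>\<^bsub>M\<^esub> b \<in> carrier M"
      using insert.prems B c by (auto intro!: left_smult_closed)
    with insert show ?case
      by (simp add: Pi_def c add)
  qed (simp add: zero)
  from this[OF B(1) subset_refl] show ?thesis
    unfolding c_def module_coord(2)[OF assms(1,2)] .
qed

lemma (in left_module) module_homs_eqI:
  assumes "module_basis R M B" "left_module R N" "f \<in> module_homs R M N" "g \<in> module_homs R M N"
    and "\<And>b. b \<in> B \<Longrightarrow> f b = g b" "x \<in> carrier M"
  shows "f x = g x"
  using assms(1,6)
proof (induction rule: module_basis_induct)
  case zero
  show ?case
    by (simp only: module_hom_zero[OF assms(2,3)] module_hom_zero[OF assms(2,4)])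
next
  case (add a b y)
  moreover have "b \<in> carrier M"
    using add assms(1) by (auto simp: module_basis_def)
  ultimately show ?case
    by (simp add: module_homsD(2,3)[OF assms(3)] module_homsD(2,3)[OF assms(4)] assms(5)
        left_smult_closed)
qed

lemma module_homs_comp:
  assumes "f \<in> module_homs R M N" "g \<in> module_homs R N L"
  shows "g \<circ> f \<in> module_homs R M L"
  unfolding module_homs_def hom_def
  by (simp add: module_homsD[OF assms(1)] module_homsD[OF assms(2)])

text \<open>The universal property of a free module: the homomorphism sends \<open>x\<close> to the combination of the
  \<open>g b\<close> with the coordinates of \<open>x\<close>. Uniqueness of coordinates is what makes it linear.\<close>

lemma (in left_module) module_basis_extend:
  assumes "module_basis R M B" "left_module R N" "g \<in> B \<rightarrow> carrier N"
  obtains f where "f \<in> module_homs R M N" "\<And>b. b \<in> B \<Longrightarrow> f b = g b"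
proof
  interpret N: left_module R N by (rule assms(2))
  have B: "finite B" "B \<subseteq> carrier M"
    using assms(1) by (auto simp: module_basis_def)
  define coord where "coord = module_coord R M B"
  have coord_closed: "coord x b \<in> carrier R" if "x \<in> carrier M" "b \<in> B" for x b
    using module_coord(1)[OF assms(1) that(1)] that(2) by (auto simp: coord_def)
  have coord_sum: "(\<Oplus>\<^bsub>M\<^esub>b\<in>B. coord x b \<odot>\<^bsub>M\<^esub> b) = x" if "x \<in> carrier M" for x
    using module_coord(2)[OF assms(1) that] by (simp add: coord_def)
  have coord_unique: "coord x b = c b"
    if "c \<in> B \<rightarrow> carrier R" "x = (\<Oplus>\<^bsub>M\<^esub>b\<in>B. c b \<odot>\<^bsub>M\<^esub> b)" "b \<in> B" for c x b
    using module_coord_unique[OF assms(1) that] by (simp add: coord_def)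
  have smult_M: "(\<lambda>b. c b \<odot>\<^bsub>M\<^esub> b) \<in> B \<rightarrow> carrier M" if "c \<in> B \<rightarrow> carrier R" for c
    using that B by (auto intro!: left_smult_closed)
  have smult_N: "(\<lambda>b. c b \<odot>\<^bsub>N\<^esub> g b) \<in> B \<rightarrow> carrier N" if "c \<in> B \<rightarrow> carrier R" for c
    using that assms(3) by (auto intro!: N.left_smult_closed)
  have coord_Pi: "coord x \<in> B \<rightarrow> carrier R" if "x \<in> carrier M" for x
    using coord_closed that by auto
  define f where "f = (\<lambda>x. \<Oplus>\<^bsub>N\<^esub>b\<in>B. coord x b \<odot>\<^bsub>N\<^esub> g b)"
  have f_eq: "f x = (\<Oplus>\<^bsub>N\<^esub>b\<in>B. c b \<odot>\<^bsub>N\<^esub> g b)"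
    if "c \<in> B \<rightarrow> carrier R" "x = (\<Oplus>\<^bsub>M\<^esub>b\<in>B. c b \<odot>\<^bsub>M\<^esub> b)" for c x
    unfolding f_def
    by (rule N.finsum_cong') (use coord_unique[OF that] smult_N[OF that(1)] in auto)
  have closed: "f x \<in> carrier N" if "x \<in> carrier M" for x
    unfolding f_def by (rule N.finsum_closed) (rule smult_N[OF coord_Pi[OF that]])
  have add: "f (x \<oplus>\<^bsub>M\<^esub> y) = f x \<oplus>\<^bsub>N\<^esub> f y" if "x \<in> carrier M" "y \<in> carrier M" for x y
  proof -
    have c: "coord x \<in> B \<rightarrow> carrier R" "coord y \<in> B \<rightarrow> carrier R"
      using that by (simp_all add: coord_Pi)
    have "x \<oplus>\<^bsub>M\<^esub> y = (\<Oplus>\<^bsub>M\<^esub>b\<in>B. coord x b \<odot>\<^bsub>M\<^esub> b \<oplus>\<^bsub>M\<^esub> coord y b \<odot>\<^bsub>M\<^esub> b)"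
      using that by (simp add: M.finsum_addf smult_M c coord_sum)
    also have "\<dots> = (\<Oplus>\<^bsub>M\<^esub>b\<in>B. (coord x b \<oplus>\<^bsub>R\<^esub> coord y b) \<odot>\<^bsub>M\<^esub> b)"
      using B that
      by (intro M.finsum_cong') (auto simp: left_smult_l_distr coord_closed
          intro!: left_smult_closed)
    finally have "f (x \<oplus>\<^bsub>M\<^esub> y) = (\<Oplus>\<^bsub>N\<^esub>b\<in>B. (coord x b \<oplus>\<^bsub>R\<^esub> coord y b) \<odot>\<^bsub>N\<^esub> g b)"
      using that by (intro f_eq) (auto simp: coord_closed)
    also have "\<dots> = (\<Oplus>\<^bsub>N\<^esub>b\<in>B. coord x b \<odot>\<^bsub>N\<^esub> g b \<oplus>\<^bsub>N\<^esub> coord y b \<odot>\<^bsub>N\<^esub> g b)"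
      using assms(3) that
      by (intro N.finsum_cong') (auto simp: N.left_smult_l_distr coord_closed Pi_def
          intro!: N.left_smult_closed)
    also have "\<dots> = f x \<oplus>\<^bsub>N\<^esub> f y"
      unfolding f_def using smult_N c by (intro N.finsum_addf)
    finally show ?thesis .
  qed
  have smult: "f (a \<odot>\<^bsub>M\<^esub> x) = a \<odot>\<^bsub>N\<^esub> f x" if "a \<in> carrier R" "x \<in> carrier M" for a x
  proof -
    have c: "coord x \<in> B \<rightarrow> carrier R"
      using that by (simp add: coord_Pi)
    have "a \<odot>\<^bsub>M\<^esub> x = (\<Oplus>\<^bsub>M\<^esub>b\<in>B. a \<odot>\<^bsub>M\<^esub> (coord x b \<odot>\<^bsub>M\<^esub> b))"
      using left_smult_finsum[OF B(1) that(1) smult_M[OF c]] that(2) by (simp add: coord_sum)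
    also have "\<dots> = (\<Oplus>\<^bsub>M\<^esub>b\<in>B. (a \<otimes>\<^bsub>R\<^esub> coord x b) \<odot>\<^bsub>M\<^esub> b)"
      using B that
      by (intro M.finsum_cong') (auto simp: left_smult_assoc coord_closed
          intro!: left_smult_closed)
    finally have "f (a \<odot>\<^bsub>M\<^esub> x) = (\<Oplus>\<^bsub>N\<^esub>b\<in>B. (a \<otimes>\<^bsub>R\<^esub> coord x b) \<odot>\<^bsub>N\<^esub> g b)"
      using that by (intro f_eq) (auto simp: coord_closed)
    also have "\<dots> = (\<Oplus>\<^bsub>N\<^esub>b\<in>B. a \<odot>\<^bsub>N\<^esub> (coord x b \<odot>\<^bsub>N\<^esub> g b))"
      using assms(3) that
      by (intro N.finsum_cong') (auto simp: N.left_smult_assoc coord_closed Pi_def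
          intro!: N.left_smult_closed)
    also have "\<dots> = a \<odot>\<^bsub>N\<^esub> f x"
      unfolding f_def by (rule N.left_smult_finsum[symmetric, OF B(1) that(1) smult_N[OF c]])
    finally show ?thesis .
  qed
  show "f \<in> module_homs R M N"
    by (auto simp: module_homs_def hom_def closed add smult)
  show "f b = g b" if "b \<in> B" for b
  proof -
    define c where "c = (\<lambda>b'. if b' = b then \<one>\<^bsub>R\<^esub> else \<zero>\<^bsub>R\<^esub>)"
    have c: "c \<in> B \<rightarrow> carrier R"
      by (auto simp: c_def)
    have "(\<Oplus>\<^bsub>M\<^esub>b'\<in>B. c b' \<odot>\<^bsub>M\<^esub> b') = (\<Oplus>\<^bsub>M\<^esub>b'\<in>B. if b = b' then b' else \<zero>\<^bsub>M\<^esub>)"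
      using B by (intro M.finsum_cong') (auto simp: c_def left_smult_one left_smult_l_null)
    also have "\<dots> = b"
      using B that by (subst M.finsum_singleton) auto
    finally have "f b = (\<Oplus>\<^bsub>N\<^esub>b'\<in>B. c b' \<odot>\<^bsub>N\<^esub> g b')"
      using c by (intro f_eq) auto
    also have "\<dots> = (\<Oplus>\<^bsub>N\<^esub>b'\<in>B. if b = b' then g b' else \<zero>\<^bsub>N\<^esub>)"
      using assms(3)
      by (intro N.finsum_cong') (auto simp: c_def N.left_smult_one N.left_smult_l_null Pi_def)
    also have "\<dots> = g b"
      using B assms(3) that by (subst N.finsum_singleton) auto
    finally show ?thesis .
  qed
qed

text \<open>The standard free module of rank \<open>n\<close>. Its elements are sequences padded with zeros, so that modules
  of all ranks are carried by one type.\<close>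

definition free_module :: "('r, 'c) ring_scheme \<Rightarrow> nat \<Rightarrow> ('r, nat \<Rightarrow> 'r) module" where
  "free_module R n =
     \<lparr>carrier = {f. range f \<subseteq> carrier R \<and> (\<forall>i\<ge>n. f i = \<zero>\<^bsub>R\<^esub>)},
      monoid.mult = undefined, one = undefined,
      zero = (\<lambda>_. \<zero>\<^bsub>R\<^esub>), add = (\<lambda>f g i. f i \<oplus>\<^bsub>R\<^esub> g i),
      smult = (\<lambda>a f i. a \<otimes>\<^bsub>R\<^esub> f i)\<rparr>"

definition unit_vector :: "('r, 'c) ring_scheme \<Rightarrow> nat \<Rightarrow> nat \<Rightarrow> 'r" where
  "unit_vector R j i = (if i = j then \<one>\<^bsub>R\<^esub> else \<zero>\<^bsub>R\<^esub>)"

lemma free_module_carrier: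
  "f \<in> carrier (free_module R n) \<longleftrightarrow> range f \<subseteq> carrier R \<and> (\<forall>i\<ge>n. f i = \<zero>\<^bsub>R\<^esub>)"
  by (simp add: free_module_def)

lemma free_module_simps [simp]:
  "\<zero>\<^bsub>free_module R n\<^esub> = (\<lambda>_. \<zero>\<^bsub>R\<^esub>)"
  "f \<oplus>\<^bsub>free_module R n\<^esub> g = (\<lambda>i. f i \<oplus>\<^bsub>R\<^esub> g i)"
  "a \<odot>\<^bsub>free_module R n\<^esub> f = (\<lambda>i. a \<otimes>\<^bsub>R\<^esub> f i)"
  by (simp_all add: free_module_def)

lemma (in ring) left_module_free_module: "left_module R (free_module R n)"
proof -
  have "abelian_group (free_module R n)"
  proof (rule abelian_groupI)
    fix f assume f: "f \<in> carrier (free_module R n)"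
    then show "\<exists>g\<in>carrier (free_module R n). g \<oplus>\<^bsub>free_module R n\<^esub> f = \<zero>\<^bsub>free_module R n\<^esub>"
      by (intro bexI[where x = "\<lambda>i. \<ominus> f i"]) (auto simp: free_module_carrier fun_eq_iff image_subset_iff l_neg)
  qed (auto simp: free_module_carrier fun_eq_iff image_subset_iff a_ac)
  then interpret F: abelian_group "free_module R n" .
  show ?thesis
    by unfold_locales
      (auto simp: free_module_carrier fun_eq_iff image_subset_iff l_distr r_distr m_assoc)
qed

lemma (in ring) module_basis_free_module:
  assumes "\<one> \<noteq> \<zero>"
  shows "module_basis R (free_module R n) (unit_vector R ` {..<n})"
  unfolding module_basis_def
proof (intro conjI ballI)
  let ?F = "free_module R n" and ?B = "unit_vector R ` {..<n}"
  interpret F: left_module R ?F by (rule left_module_free_module)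
  show B: "finite ?B" "?B \<subseteq> carrier ?F"
    by (auto simp: free_module_carrier unit_vector_def split: if_splits)
  have inj: "unit_vector R i = unit_vector R j \<longleftrightarrow> i = j" for i j
    using assms by (metis unit_vector_def)
  have finsum_apply: "(finsum ?F h C) i = (\<Oplus>b\<in>C. h b i)"
    if "finite C" "h \<in> C \<rightarrow> carrier ?F" for h C and i
    using that
  proof (induction C)
    case (insert b C)
    then have h: "h \<in> C \<rightarrow> carrier ?F" "h b \<in> carrier ?F"
      by auto
    then have R: "(\<lambda>b. h b i) \<in> C \<rightarrow> carrier R" "h b i \<in> carrier R"
      by (auto simp: free_module_carrier image_subset_iff Pi_iff)
    have "finsum ?F h (insert b C) = h b \<oplus>\<^bsub>?F\<^esub> finsum ?F h C"
      using insert.hyps h by (rule F.M.finsum_insert)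
    then show ?case
      using insert.IH[OF h(1)] insert.hyps R by (simp add: finsum_insert)
  qed simp
  have comb: "(\<Oplus>\<^bsub>?F\<^esub>b\<in>?B. c b \<odot>\<^bsub>?F\<^esub> b) i = (if i < n then c (unit_vector R i) else \<zero>)"
    if c: "c \<in> ?B \<rightarrow> carrier R" for c i
  proof -
    have "(\<lambda>b. c b \<odot>\<^bsub>?F\<^esub> b) \<in> ?B \<rightarrow> carrier ?F"
      using c B(2) by (blast intro: F.left_smult_closed)
    then have "(\<Oplus>\<^bsub>?F\<^esub>b\<in>?B. c b \<odot>\<^bsub>?F\<^esub> b) i = (\<Oplus>b\<in>?B. c b \<otimes> b i)"
      using B(1) by (simp only: finsum_apply) simp
    also have "\<dots> = (\<Oplus>b\<in>?B. if unit_vector R i = b then c b else \<zero>)"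
      using c
      by (intro finsum_cong') (auto simp: inj Pi_iff unit_vector_def[of R _ i])
    also have "\<dots> = (if i < n then c (unit_vector R i) else \<zero>)"
    proof (cases "i < n")
      case True
      then show ?thesis
        using c B(1) by (subst finsum_singleton) (auto simp: Pi_iff)
    next
      case False
      then have "(\<Oplus>b\<in>?B. if unit_vector R i = b then c b else \<zero>) = (\<Oplus>b\<in>?B. \<zero>)"
        by (intro finsum_cong') (auto simp: inj)
      with False show ?thesis by simp
    qed
    finally show ?thesis .
  qed
  fix x assume x: "x \<in> carrier ?F"
  show "\<exists>!c. c \<in> ?B \<rightarrow>\<^sub>E carrier R \<and> x = (\<Oplus>\<^bsub>?F\<^esub>b\<in>?B. c b \<odot>\<^bsub>?F\<^esub> b)"
  proof (rule ex1I)
    let ?c = "\<lambda>b\<in>?B. x (THE i. b = unit_vector R i)"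
    have c: "?c (unit_vector R i) = x i" if "i < n" for i
      using that by (simp add: inj)
    have "?c \<in> ?B \<rightarrow>\<^sub>E carrier R"
      using x by (auto simp: free_module_carrier)
    moreover have "x = (\<Oplus>\<^bsub>?F\<^esub>b\<in>?B. ?c b \<odot>\<^bsub>?F\<^esub> b)"
    proof
      fix i
      have "?c \<in> ?B \<rightarrow> carrier R"
        using x by (auto simp: free_module_carrier)
      from comb[OF this, of i] show "x i = (\<Oplus>\<^bsub>?F\<^esub>b\<in>?B. ?c b \<odot>\<^bsub>?F\<^esub> b) i"
        using x c[of i] by (simp add: free_module_carrier del: restrict_apply)
    qed
    ultimately show "?c \<in> ?B \<rightarrow>\<^sub>E carrier R \<and> x = (\<Oplus>\<^bsub>?F\<^esub>b\<in>?B. ?c b \<odot>\<^bsub>?F\<^esub> b)" ..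
    fix d assume d: "d \<in> ?B \<rightarrow>\<^sub>E carrier R \<and> x = (\<Oplus>\<^bsub>?F\<^esub>b\<in>?B. d b \<odot>\<^bsub>?F\<^esub> b)"
    then have "d \<in> ?B \<rightarrow> carrier R"
      by auto
    from comb[OF this] have "d (unit_vector R i) = x i" if "i < n" for i
      using d that by simp
    then show "d = ?c"
      using d c by (intro PiE_ext[of d ?B "\<lambda>_. carrier R"]) (use x in \<open>auto simp: free_module_carrier\<close>)
  qed
qed

section \<open>FP1 and connectivity of Cayley graphs\<close>

text \<open>The Cayley graph has the edges \<open>m \<midarrow> m a\<close>. A predicate that does not change along edges is a
  union of connected components, so the condition says that the component of the identity is
  everything. In this form connectivity is used by choosing \<open>P\<close>.\<close>

definition cayley_connected :: "('a, 'c) monoid_scheme \<Rightarrow> 'a set \<Rightarrow> bool" where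
  "cayley_connected M A \<longleftrightarrow>
     (\<forall>P. P \<one>\<^bsub>M\<^esub> \<and> (\<forall>m\<in>carrier M. \<forall>a\<in>A. P (m \<otimes>\<^bsub>M\<^esub> a) \<longleftrightarrow> P m) \<longrightarrow> (\<forall>m\<in>carrier M. P m))"

definition finitely_connected :: "('a, 'c) monoid_scheme \<Rightarrow> bool" where
  "finitely_connected M \<longleftrightarrow> (\<exists>A. finite A \<and> A \<subseteq> carrier M \<and> cayley_connected M A)"

lemma trivial_module_simps [simp]:
  "carrier trivial_module = UNIV" "\<zero>\<^bsub>trivial_module\<^esub> = 0"
  "x \<oplus>\<^bsub>trivial_module\<^esub> y = x + y" "p \<odot>\<^bsub>trivial_module\<^esub> x = augmentation p * x"
  by (simp_all add: trivial_module_def)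

lemma augmentation_add: "augmentation (p + q) = augmentation p + augmentation q"
  by (simp add: augmentation_eq_coefficient_sum coefficient_sum_add)

lemma augmentation_diff: "augmentation (p - q) = augmentation p - augmentation q"
  by (simp add: augmentation_eq_coefficient_sum coefficient_sum_diff)

lemma augmentation_single [simp]: "augmentation (Poly_Mapping.single x k) = k"
  by (simp add: augmentation_def)

lemma augmentation_0 [simp]: "augmentation 0 = 0"
  by (simp add: augmentation_def)

lemma augmentation_mult:
  assumes "Poly_Mapping.keys p \<subseteq> carrier M"
  shows "augmentation (p \<otimes>\<^bsub>monoid_ring M\<^esub> q) = augmentation p * augmentation q"
  using coefficient_sum_mult[OF assms, of q "\<lambda>_. True"]
  by (simp add: augmentation_eq_coefficient_sum)

lemma (in monoid) left_module_trivial_module: "left_module (monoid_ring G) trivial_module"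
proof -
  interpret R: ring "monoid_ring G" by (rule ring_monoid_ring)
  have "abelian_group trivial_module"
    by (rule abelian_groupI) (auto intro: exI[where x = "- x" for x :: int])
  then interpret Z: abelian_group trivial_module .
  show ?thesis
    by unfold_locales (auto simp: augmentation_add augmentation_mult algebra_simps)
qed

lemma augmentation_hom:
  "(\<lambda>x. augmentation (x 0)) \<in> module_homs (monoid_ring M) (free_module (monoid_ring M) 1) trivial_module"
  by (auto simp: module_homs_def hom_def augmentation_add augmentation_mult)

text \<open>The identification of \<open>\<int>M\<close> with the free module of rank one.\<close>

definition rank_one_vector :: "('a \<Rightarrow>\<^sub>0 int) \<Rightarrow> nat \<Rightarrow> 'a \<Rightarrow>\<^sub>0 int" where
  "rank_one_vector p i = (if i = 0 then p else 0)"

lemma rank_one_vector_0 [simp]: "rank_one_vector p 0 = p"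
  by (simp add: rank_one_vector_def)

lemma rank_one_vector_closed [simp]:
  assumes "0 < n"
  shows "rank_one_vector p \<in> carrier (free_module (monoid_ring M) n)
    \<longleftrightarrow> Poly_Mapping.keys p \<subseteq> carrier M"
  using assms by (auto simp: free_module_carrier rank_one_vector_def)

lemma rank_one_vector_eq:
  assumes "x \<in> carrier (free_module (monoid_ring M) 1)"
  shows "rank_one_vector (x 0) = x"
  using assms by (auto simp: free_module_carrier rank_one_vector_def fun_eq_iff)

lemma rank_one_vector_hom:
  "\<zero>\<^bsub>free_module (monoid_ring M) n\<^esub> = rank_one_vector 0"
  "rank_one_vector p \<oplus>\<^bsub>free_module (monoid_ring M) n\<^esub> rank_one_vector q = rank_one_vector (p + q)"
  "a \<odot>\<^bsub>free_module (monoid_ring M) n\<^esub> rank_one_vector p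
    = rank_one_vector (a \<otimes>\<^bsub>monoid_ring M\<^esub> p)"
  by (auto simp: rank_one_vector_def)

text \<open>Since \<open>A0\<close> is free, \<open>d0 : A0 \<rightarrow> \<int>\<close> lifts through the augmentation to \<open>f : A0 \<rightarrow> \<int>M\<close>. Let \<open>A\<close>
  collect the supports of the images under \<open>f\<close> of the finitely many generators of \<open>ker d0\<close>, and of
  one \<open>x0\<close> with \<open>d0 x0 = 1\<close>. If \<open>P\<close> is a union of components, the functional
  \<open>\<Phi> = coefficient_sum P \<circ> f\<close> vanishes on \<open>ker d0\<close>, hence takes the same value on \<open>m x0\<close> and
  \<open>x0\<close>. These two values are the truth values of \<open>P m\<close> and \<open>P 1\<close>.\<close>

lemma (in monoid) finitely_connected_if_left_FP1:
  assumes "left_FP1 G"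
  shows "finitely_connected G"
proof -
  let ?R = "monoid_ring G" and ?F = "free_module (monoid_ring G) 1"
  obtain A1 A0 :: "('a \<Rightarrow>\<^sub>0 int, nat \<Rightarrow> 'a \<Rightarrow>\<^sub>0 int) module" and d1 d0 B1 B0 where
    A1: "left_module ?R A1" and A0: "left_module ?R A0" and
    B1: "module_basis ?R A1 B1" and B0: "module_basis ?R A0 B0" and
    d1: "d1 \<in> module_homs ?R A1 A0" and d0: "d0 \<in> module_homs ?R A0 trivial_module" and
    exact: "d1 ` carrier A1 = {x \<in> carrier A0. d0 x = 0}" and
    surj: "d0 ` carrier A0 = UNIV"
    using assms by (auto simp: left_FP1_def fin_gen_free_def exact_presentation_def)
  interpret R: ring ?R by (rule ring_monoid_ring)
  interpret A1: left_module ?R A1 by (rule A1)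
  interpret A0: left_module ?R A0 by (rule A0)
  have F: "left_module ?R ?F"
    by (rule R.left_module_free_module)
  have "(\<lambda>b. rank_one_vector (Poly_Mapping.single \<one> (d0 b))) \<in> B0 \<rightarrow> carrier ?F"
    by auto
  from A0.module_basis_extend[OF B0 F this] obtain f where
    f: "f \<in> module_homs ?R A0 ?F" and
    f_B0: "\<And>b. b \<in> B0 \<Longrightarrow> f b = rank_one_vector (Poly_Mapping.single \<one> (d0 b))"
    by blast
  have aug_f: "augmentation (f x 0) = d0 x" if "x \<in> carrier A0" for x
    using A0.module_homs_eqI[OF B0 left_module_trivial_module
        module_homs_comp[OF f augmentation_hom] d0 _ that]
    by (simp add: f_B0)
  obtain x0 where x0: "x0 \<in> carrier A0" "d0 x0 = 1"
    using surj by (metis UNIV_I imageE)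
  define A where "A = (\<Union>b\<in>B1. Poly_Mapping.keys (f (d1 b) 0)) \<union> Poly_Mapping.keys (f x0 0)"
  have B1': "finite B1" "B1 \<subseteq> carrier A1"
    using B1 by (auto simp: module_basis_def)
  have f_keys: "Poly_Mapping.keys (f x 0) \<subseteq> carrier G" if "x \<in> carrier A0" for x
    using module_homsD(1)[OF f that] by (auto simp: free_module_carrier)
  have "finite A"
    by (simp add: A_def B1')
  moreover have "A \<subseteq> carrier G"
    unfolding A_def
  proof (intro Un_least UN_least f_keys x0(1))
    show "d1 b \<in> carrier A0" if "b \<in> B1" for b
      using B1'(2) that by (intro module_homsD(1)[OF d1]) auto
  qed
  moreover have "cayley_connected G A"
    unfolding cayley_connected_def
  proof (intro allI impI ballI)
    fix P m
    assume P: "P \<one> \<and> (\<forall>m\<in>carrier G. \<forall>a\<in>A. P (m \<otimes> a) \<longleftrightarrow> P m)" and m: "m \<in> carrier G"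
    define \<Phi> where "\<Phi> x = coefficient_sum P (f x 0)" for x
    have \<Phi>_add: "\<Phi> (x \<oplus>\<^bsub>A0\<^esub> y) = \<Phi> x + \<Phi> y" if "x \<in> carrier A0" "y \<in> carrier A0" for x y
      by (simp add: \<Phi>_def module_homsD(2)[OF f that] coefficient_sum_add)
    have \<Phi>_smult: "\<Phi> (a \<odot>\<^bsub>A0\<^esub> x) = coefficient_sum P a * d0 x"
      if "a \<in> carrier ?R" "x \<in> carrier A0" "Poly_Mapping.keys (f x 0) \<subseteq> A" for a x
    proof -
      have "coefficient_sum P (a \<otimes>\<^bsub>?R\<^esub> f x 0) = coefficient_sum P a * augmentation (f x 0)"
        by (rule coefficient_sum_mult) (use that P in auto)
      then show ?thesis
        by (simp add: \<Phi>_def module_homsD(3)[OF f that(1,2)] aug_f that(2))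
    qed
    \<comment> \<open>on a multiple of a generator, \<open>\<Phi>\<close> has the factor \<open>d0 (d1 b) = 0\<close>\<close>
    have \<Phi>_0: "\<Phi> (d1 y) = 0" if "y \<in> carrier A1" for y
      using B1 that
    proof (induction rule: A1.module_basis_induct)
      case zero
      have "\<Phi> (\<zero>\<^bsub>A0\<^esub> \<oplus>\<^bsub>A0\<^esub> \<zero>\<^bsub>A0\<^esub>) = \<Phi> \<zero>\<^bsub>A0\<^esub> + \<Phi> \<zero>\<^bsub>A0\<^esub>"
        by (rule \<Phi>_add) simp_all
      then show ?case
        by (simp add: A1.module_hom_zero[OF A0 d1])
    next
      case (add a b y)
      then have b: "b \<in> carrier A1" "d1 b \<in> carrier A0" "d0 (d1 b) = 0"
        using B1' exact by auto
      have "Poly_Mapping.keys (f (d1 b) 0) \<subseteq> A"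
        using add(2) by (auto simp: A_def)
      then have "\<Phi> (a \<odot>\<^bsub>A0\<^esub> d1 b) = 0"
        using add(1) b by (subst \<Phi>_smult) auto
      moreover have "a \<odot>\<^bsub>A0\<^esub> d1 b \<in> carrier A0" "d1 y \<in> carrier A0" "a \<odot>\<^bsub>A1\<^esub> b \<in> carrier A1"
        using add(1,3) b module_homsD(1)[OF d1]
        by (auto intro: A0.left_smult_closed A1.left_smult_closed)
      ultimately show ?case
        using add(1,3,4) b(1)
        by (simp add: module_homsD(2,3)[OF d1] \<Phi>_add del: monoid_ring_simps)
    qed
    define x where "x = frag_of m \<odot>\<^bsub>A0\<^esub> x0"
    have mR: "frag_of m \<in> carrier ?R" "frag_of \<one> \<in> carrier ?R"
      using m by auto
    have x: "x \<in> carrier A0"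
      using mR x0 by (simp add: x_def A0.left_smult_closed del: monoid_ring_simps)
    define z where "z = x \<ominus>\<^bsub>A0\<^esub> x0"
    have z: "z \<in> carrier A0" "x = z \<oplus>\<^bsub>A0\<^esub> x0"
      using x x0(1)
      by (simp_all add: z_def A0.M.minus_closed a_minus_def A0.M.a_assoc A0.M.l_neg)
    have "d0 x = d0 x0"
      using mR x0 by (simp add: x_def module_homsD(3)[OF d0] del: monoid_ring_simps)
    then have "d0 z = 0"
      using module_homsD(2)[OF d0 z(1) x0(1)] z(2) by simp
    then obtain y where "y \<in> carrier A1" "z = d1 y"
      using z(1) exact by blast
    then have "\<Phi> x = \<Phi> x0"
      using \<Phi>_0 \<Phi>_add[OF z(1) x0(1)] z(2) by simp
    moreover have keys_x0: "Poly_Mapping.keys (f x0 0) \<subseteq> A"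
      by (simp add: A_def)
    have "\<Phi> x = (if P m then 1 else 0)"
      unfolding x_def using \<Phi>_smult[OF mR(1) x0(1) keys_x0] x0(2) by simp
    moreover have "\<Phi> x0 = (if P \<one> then 1 else 0)"
      using \<Phi>_smult[OF mR(2) x0(1) keys_x0] x0 A0.left_smult_one[OF x0(1)] by simp
    ultimately show "P m"
      using P by (simp split: if_splits)
  qed
  ultimately show ?thesis
    by (auto simp: finitely_connected_def)
qed

text \<open>The presentation is \<open>(\<int>M)\<^sup>A \<rightarrow> \<int>M \<rightarrow> \<int> \<rightarrow> 0\<close>, where the basis vector of \<open>a\<close> goes to \<open>a - 1\<close>. The
  image \<open>W\<close> of the first map contains the differences \<open>m a - m\<close>, so the set of those \<open>m\<close> with
  \<open>m - 1 \<in> W\<close> is a union of components of the Cayley graph. By connectivity it is all of \<open>M\<close>, and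
  the differences \<open>m - 1\<close> span the kernel of the augmentation.\<close>

lemma (in monoid) left_FP1_if_finitely_connected:
  assumes "finitely_connected G"
  shows "left_FP1 G"
proof -
  let ?R = "monoid_ring G"
  obtain A where A: "finite A" "A \<subseteq> carrier G" "cayley_connected G A"
    using assms by (auto simp: finitely_connected_def)
  interpret R: ring ?R by (rule ring_monoid_ring)
  define n where "n = card A"
  let ?A1 = "free_module ?R n" and ?A0 = "free_module ?R 1"
  define B where "B = unit_vector ?R ` {..<n}"
  have R_nontrivial: "\<one>\<^bsub>?R\<^esub> \<noteq> \<zero>\<^bsub>?R\<^esub>"
    by simp
  have B: "module_basis ?R ?A1 B" "finite B" "B \<subseteq> carrier ?A1"
    using R.module_basis_free_module[OF R_nontrivial, of n]
    unfolding B_def module_basis_def by auto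
  interpret A1: left_module ?R ?A1 by (rule R.left_module_free_module)
  interpret A0: left_module ?R ?A0 by (rule R.left_module_free_module)
  have "inj_on (unit_vector ?R) {..<n}"
    by (rule inj_onI) (metis R_nontrivial unit_vector_def)
  then have "card B = card A"
    by (simp add: B_def card_image n_def)
  then obtain h where h: "bij_betw h B A"
    using finite_same_card_bij A(1) B(2) by blast
  have "Poly_Mapping.keys (frag_of (h b) - frag_of \<one>) \<subseteq> carrier G" if "b \<in> B" for b
    using keys_diff[of "frag_of (h b)" "frag_of \<one>"] A(2) bij_betwE[OF h] that by auto
  then have "(\<lambda>b. rank_one_vector (frag_of (h b) - frag_of \<one>)) \<in> B \<rightarrow> carrier ?A0"
    by simp
  from A1.module_basis_extend[OF B(1) R.left_module_free_module this] obtain d1 where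
    d1: "d1 \<in> module_homs ?R ?A1 ?A0" and
    d1_B: "\<And>b. b \<in> B \<Longrightarrow> d1 b = rank_one_vector (frag_of (h b) - frag_of \<one>)"
    by blast
  define d0 :: "(nat \<Rightarrow> 'a \<Rightarrow>\<^sub>0 int) \<Rightarrow> int" where "d0 x = augmentation (x 0)" for x
  have d0: "d0 \<in> module_homs ?R ?A0 trivial_module"
    unfolding d0_def by (rule augmentation_hom)
  define W where "W = {p. \<exists>y\<in>carrier ?A1. rank_one_vector p = d1 y}"
  have W_I: "p \<in> W" if "rank_one_vector p = d1 y" "y \<in> carrier ?A1" for p y
    unfolding W_def by (rule CollectI, rule bexI) (fact that)+
  have W_E: "\<exists>y\<in>carrier ?A1. rank_one_vector p = d1 y" if "p \<in> W" for p
    using that unfolding W_def mem_Collect_eq .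
  have W_0: "0 \<in> W"
  proof -
    have "rank_one_vector 0 = d1 \<zero>\<^bsub>?A1\<^esub>"
      unfolding A1.module_hom_zero[OF R.left_module_free_module d1]
      unfolding rank_one_vector_hom ..
    then show ?thesis
      by (rule W_I) (rule A1.M.zero_closed)
  qed
  have W_add: "p + q \<in> W" if "p \<in> W" "q \<in> W" for p q
  proof -
    from W_E[OF that(1)] obtain y where y: "y \<in> carrier ?A1" "rank_one_vector p = d1 y"
      by (rule bexE)
    from W_E[OF that(2)] obtain z where z: "z \<in> carrier ?A1" "rank_one_vector q = d1 z"
      by (rule bexE)
    have "rank_one_vector (p + q) = d1 (y \<oplus>\<^bsub>?A1\<^esub> z)"
      unfolding module_homsD(2)[OF d1 y(1) z(1)] y(2)[symmetric] z(2)[symmetric] rank_one_vector_hom ..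
    then show ?thesis
      by (rule W_I) (rule A1.M.a_closed[OF y(1) z(1)])
  qed
  have W_mult: "a \<otimes>\<^bsub>?R\<^esub> p \<in> W" if "p \<in> W" "a \<in> carrier ?R" for a p
  proof -
    from W_E[OF that(1)] obtain y where y: "y \<in> carrier ?A1" "rank_one_vector p = d1 y"
      by (rule bexE)
    have "rank_one_vector (a \<otimes>\<^bsub>?R\<^esub> p) = d1 (a \<odot>\<^bsub>?A1\<^esub> y)"
      unfolding module_homsD(3)[OF d1 that(2) y(1)] y(2)[symmetric] rank_one_vector_hom ..
    then show ?thesis
      by (rule W_I) (rule A1.left_smult_closed[OF that(2) y(1)])
  qed
  have W_carrier: "Poly_Mapping.keys p \<subseteq> carrier G" if "p \<in> W" for p
  proof -
    from W_E[OF that] obtain y where "y \<in> carrier ?A1" "rank_one_vector p = d1 y"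
      by (rule bexE)
    with module_homsD(1)[OF d1, of y] have "rank_one_vector p \<in> carrier ?A0"
      by (simp only:)
    then show ?thesis
      by simp
  qed
  have W_diff: "p - q \<in> W" if "p \<in> W" "q \<in> W" for p q
  proof -
    have "(0 - frag_of \<one>) \<otimes>\<^bsub>?R\<^esub> q = - q"
      using R.l_one[of q] W_carrier[OF that(2)] by (simp only: monoid_ring_mult_diff) simp
    moreover have "(0 - frag_of \<one>) \<in> carrier ?R"
      by simp
    ultimately show ?thesis
      using W_add[OF that(1) W_mult[OF that(2)]] by (metis add_uminus_conv_diff)
  qed
  have edge: "frag_of (m \<otimes> a) - frag_of m \<in> W" if "m \<in> carrier G" "a \<in> A" for m a
  proof -
    from h that(2) obtain b where "b \<in> B" "h b = a"
      by (auto simp: bij_betw_def)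
    then have "frag_of a - frag_of \<one> \<in> W"
      using d1_B B(3) by (intro W_I[of _ b]) auto
    from W_mult[OF this, of "frag_of m"] show ?thesis
      using that by (simp add: monoid_ring_mult_diff)
  qed
  have vertex: "frag_of m - frag_of \<one> \<in> W" if "m \<in> carrier G" for m
  proof -
    have "frag_of (m \<otimes> a) - frag_of \<one> \<in> W \<longleftrightarrow> frag_of m - frag_of \<one> \<in> W"
      if "m \<in> carrier G" "a \<in> A" for m a
      using W_add[OF edge[OF that], of "frag_of m - frag_of \<one>"]
        W_diff[OF _ edge[OF that], of "frag_of (m \<otimes> a) - frag_of \<one>"] by auto
    moreover have "frag_of \<one> - frag_of \<one> \<in> W"
      by (simp add: W_0)
    ultimately show ?thesis
      using A(3)[unfolded cayley_connected_def, THEN spec[of _ "\<lambda>m. frag_of m - frag_of \<one> \<in> W"]] that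
      by blast
  qed
  have W_aug: "p - Poly_Mapping.single \<one> (augmentation p) \<in> W"
    if "Poly_Mapping.keys p \<subseteq> carrier G" for p
    using that
  proof (induction rule: frag_induction)
    case (diff p q)
    from W_diff[OF diff] show ?case
      by (simp add: augmentation_diff single_diff algebra_simps)
  qed (simp_all add: W_0 vertex)
  have "exact_presentation ?R ?A1 ?A0 trivial_module d1 d0"
    unfolding exact_presentation_def
  proof (intro conjI d1 d0 equalityI subsetI)
    fix x assume "x \<in> d1 ` carrier ?A1"
    then obtain y where y: "y \<in> carrier ?A1" "x = d1 y"
      by blast
    have "d0 (d1 y) = 0"
      using B(1) y(1)
    proof (induction rule: A1.module_basis_induct)
      case zero
      show ?case
        using A1.module_hom_zero[OF left_module_trivial_module module_homs_comp[OF d1 d0]]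
        by (simp only: o_def trivial_module_simps)
    next
      case (add a b y)
      then have b: "b \<in> carrier ?A1" "d0 (d1 b) = 0"
        using B(3) by (auto simp: d1_B d0_def augmentation_diff)
      have "(d0 \<circ> d1) (a \<odot>\<^bsub>?A1\<^esub> b \<oplus>\<^bsub>?A1\<^esub> y) = augmentation a * (d0 \<circ> d1) b + (d0 \<circ> d1) y"
        using module_homsD(2,3)[OF module_homs_comp[OF d1 d0]] A1.left_smult_closed[OF add(1) b(1)]
          add(1,3) b(1)
        by (simp del: monoid_ring_simps)
      then show ?case
        using add(4) b(2) by simp
    qed
    then show "x \<in> {x \<in> carrier ?A0. d0 x = \<zero>\<^bsub>trivial_module\<^esub>}"
      using y module_homsD(1)[OF d1 y(1)] by simp
  next
    fix x assume "x \<in> {x \<in> carrier ?A0. d0 x = \<zero>\<^bsub>trivial_module\<^esub>}"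
    then have x: "x \<in> carrier ?A0" "augmentation (x 0) = 0"
      by (simp_all add: d0_def)
    then have "x 0 \<in> W"
      using W_aug[of "x 0"] by (auto simp: free_module_carrier)
    from W_E[OF this] obtain y where "y \<in> carrier ?A1" "rank_one_vector (x 0) = d1 y"
      by (rule bexE)
    then show "x \<in> d1 ` carrier ?A1"
      unfolding rank_one_vector_eq[OF x(1)] by blast
  next
    fix k :: int
    have "rank_one_vector (Poly_Mapping.single \<one> k) \<in> carrier ?A0"
      "d0 (rank_one_vector (Poly_Mapping.single \<one> k)) = k"
      by (simp_all add: d0_def)
    then show "k \<in> d0 ` carrier ?A0"
      by (metis imageI)
  qed simp
  moreover have "fin_gen_free ?R ?A1" "fin_gen_free ?R ?A0"
    using R.module_basis_free_module[OF R_nontrivial] by (auto simp: fin_gen_free_def)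
  ultimately show ?thesis
    unfolding left_FP1_def using R.left_module_free_module by blast
qed

theorem (in monoid) left_FP1_iff_finitely_connected: "left_FP1 G \<longleftrightarrow> finitely_connected G"
  using finitely_connected_if_left_FP1 left_FP1_if_finitely_connected by blast

section \<open>Finitely generated groups\<close>

lemma finitely_generated_group_surj:
  assumes "group G" "group H" "h \<in> hom G H" "h ` carrier G = carrier H"
    and "finitely_generated_group G"
  shows "finitely_generated_group H"
proof -
  interpret group_hom G H h
    using assms(1-3) by (simp add: group_hom_def group_hom_axioms_def)
  obtain A where A: "finite A" "A \<subseteq> carrier G" "generate G A = carrier G"
    using assms(5) by (auto simp: finitely_generated_group_def)
  have "generate H (h ` A) = carrier H"
    using generate_img[OF A(2)] A(3) assms(4) by simp
  then show ?thesis
    using A(1,2) unfolding finitely_generated_group_def by (intro exI[of _ "h ` A"]) auto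
qed

lemma (in group) group_opposite: "group (opposite G)"
  by (rule groupI) (auto simp: m_assoc intro: r_inv)

text \<open>Inversion is an isomorphism between a group and its opposite.\<close>

lemma (in group) finitely_generated_group_opposite:
  "finitely_generated_group (opposite G) \<longleftrightarrow> finitely_generated_group G"
proof
  have inv: "m_inv G \<in> hom G (opposite G)" "m_inv G \<in> hom (opposite G) G"
    by (auto simp: hom_def inv_mult_group)
  have surj: "m_inv G ` carrier G = carrier G"
    using inv_inv inv_closed by (metis (no_types, opaque_lifting) image_eqI image_subsetI subsetI subset_antisym)
  show "finitely_generated_group (opposite G) \<Longrightarrow> finitely_generated_group G"
    by (rule finitely_generated_group_surj[OF group_opposite is_group inv(2)]) (simp_all add: surj)
  show "finitely_generated_group G \<Longrightarrow> finitely_generated_group (opposite G)"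
    by (rule finitely_generated_group_surj[OF is_group group_opposite inv(1)]) (simp_all add: surj)
qed

lemma (in group) mult_mem_subgroup_iff:
  assumes "subgroup X G" "h \<in> carrier G" "x \<in> X"
  shows "h \<otimes> x \<in> X \<longleftrightarrow> h \<in> X"
proof
  have x: "x \<in> carrier G" "inv x \<in> X"
    using assms subgroup.mem_carrier subgroup.m_inv_closed by fast+
  assume "h \<otimes> x \<in> X"
  then have "(h \<otimes> x) \<otimes> inv x \<in> X"
    using assms(1) x(2) by (rule_tac subgroup.m_closed)
  then show "h \<in> X"
    using assms(2) x(1) by (simp add: m_assoc)
qed (use assms in \<open>auto intro: subgroup.m_closed\<close>)

section \<open>Idempotents in the kernel of a monoid\<close>

definition principal_left_ideal :: "('a, 'c) monoid_scheme \<Rightarrow> 'a \<Rightarrow> 'a set" where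
  "principal_left_ideal M x = (\<lambda>m. m \<otimes>\<^bsub>M\<^esub> x) ` carrier M"

definition principal_right_ideal :: "('a, 'c) monoid_scheme \<Rightarrow> 'a \<Rightarrow> 'a set" where
  "principal_right_ideal M x = (\<lambda>m. x \<otimes>\<^bsub>M\<^esub> m) ` carrier M"

definition corner :: "('a, 'c) monoid_scheme \<Rightarrow> 'a \<Rightarrow> 'a monoid" where
  "corner M e = \<lparr>carrier = {e \<otimes>\<^bsub>M\<^esub> m \<otimes>\<^bsub>M\<^esub> e | m. m \<in> carrier M},
     monoid.mult = monoid.mult M, one = e\<rparr>"

lemma corner_simps [simp]:
  "x \<otimes>\<^bsub>corner M e\<^esub> y = x \<otimes>\<^bsub>M\<^esub> y" "\<one>\<^bsub>corner M e\<^esub> = e"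
  by (simp_all add: corner_def)

text \<open>The last condition places \<open>e\<close> in every principal two-sided ideal, that is, in the minimal ideal
  (the kernel) of the monoid.\<close>

locale kernel_idempotent = monoid G for G (structure) and e +
  assumes e_closed [simp]: "e \<in> carrier G"
    and e_idem [simp]: "e \<otimes> e = e"
    and finite_left: "finite (principal_left_ideal G ` carrier G)"
    and finite_right: "finite (principal_right_ideal G ` carrier G)"
    and kernel: "x \<in> carrier G \<Longrightarrow> \<exists>a\<in>carrier G. \<exists>b\<in>carrier G. e = a \<otimes> x \<otimes> b"
begin

lemma corner_carrier:
  "x \<in> carrier (corner G e) \<longleftrightarrow> x \<in> carrier G \<and> e \<otimes> x = x \<and> x \<otimes> e = x"
proof
  assume "x \<in> carrier (corner G e)"
  then obtain m where m: "m \<in> carrier G" "x = e \<otimes> m \<otimes> e"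
    by (auto simp: corner_def)
  have "e \<otimes> x = (e \<otimes> e) \<otimes> m \<otimes> e" "x \<otimes> e = e \<otimes> m \<otimes> (e \<otimes> e)"
    using m by (simp_all only: m_assoc m_closed e_closed)
  then show "x \<in> carrier G \<and> e \<otimes> x = x \<and> x \<otimes> e = x"
    using m by simp
next
  assume "x \<in> carrier G \<and> e \<otimes> x = x \<and> x \<otimes> e = x"
  then show "x \<in> carrier (corner G e)"
    by (auto simp: corner_def intro!: exI[of _ x])
qed

lemma cornerI [intro]: "m \<in> carrier G \<Longrightarrow> e \<otimes> m \<otimes> e \<in> carrier (corner G e)"
  by (auto simp: corner_def)

text \<open>The left ideal \<open>M e\<close> is minimal. Take a minimal principal left ideal \<open>M z\<close> and write
  \<open>e = a z b\<close>. For \<open>x = x e = x a z b\<close>, minimality gives \<open>z \<in> M x a z\<close>, and multiplying by \<open>a\<close> on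
  the left and by \<open>b\<close> on the right turns this into \<open>e \<in> M x\<close>.\<close>

lemma idempotent_mem_principal_left_ideal:
  assumes x: "x \<in> carrier G" "x \<otimes> e = x"
  shows "\<exists>m\<in>carrier G. e = m \<otimes> x"
proof -
  have "principal_left_ideal G ` carrier G \<noteq> {}"
    using one_closed by blast
  from finite_has_minimal[OF finite_left this] obtain L where
    "L \<in> principal_left_ideal G ` carrier G" and
    L_min: "\<forall>J\<in>principal_left_ideal G ` carrier G. J \<subseteq> L \<longrightarrow> L = J"
    by (elim bexE)
  then obtain z where z: "z \<in> carrier G" and L: "L = principal_left_ideal G z"
    by blast
  obtain a b where ab: "a \<in> carrier G" "b \<in> carrier G" "e = a \<otimes> z \<otimes> b"
    using kernel[OF z] by blast
  let ?w = "x \<otimes> a \<otimes> z"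
  have w: "?w \<in> carrier G"
    using x ab z by simp
  have "principal_left_ideal G ?w \<subseteq> principal_left_ideal G z"
    unfolding principal_left_ideal_def
  proof
    fix y assume "y \<in> (\<lambda>m. m \<otimes> ?w) ` carrier G"
    then obtain m where "m \<in> carrier G" "y = m \<otimes> ?w"
      by blast
    then show "y \<in> (\<lambda>m. m \<otimes> z) ` carrier G"
      using x ab z by (intro image_eqI[of _ _ "m \<otimes> x \<otimes> a"]) (simp_all add: m_assoc)
  qed
  then have "principal_left_ideal G z = principal_left_ideal G ?w"
    using L_min w by (simp add: L)
  moreover have "z \<in> principal_left_ideal G z"
    using z by (simp add: principal_left_ideal_def image_iff) (metis l_one one_closed)
  ultimately obtain c where c: "c \<in> carrier G" "z = c \<otimes> ?w"
    by (auto simp: principal_left_ideal_def)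
  have "e = a \<otimes> (c \<otimes> ?w) \<otimes> b"
    using ab(3) c(2) by simp
  also have "\<dots> = a \<otimes> c \<otimes> (x \<otimes> (a \<otimes> z \<otimes> b))"
    using x ab z c(1) by (simp add: m_assoc)
  also have "\<dots> = a \<otimes> c \<otimes> x"
    using ab(3) x(2) by simp
  finally show ?thesis
    using ab(1) c(1) by blast
qed

lemma group_corner: "group (corner G e)"
proof (rule groupI)
  fix x assume x: "x \<in> carrier (corner G e)"
  then obtain m where m: "m \<in> carrier G" "e = m \<otimes> x"
    using idempotent_mem_principal_left_ideal by (auto simp: corner_carrier)
  have "e \<otimes> m \<otimes> e \<otimes> x = e \<otimes> (m \<otimes> (e \<otimes> x))"
    using m(1) x by (simp add: corner_carrier m_assoc)
  also have "\<dots> = e"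
    using m(2) x by (simp add: corner_carrier flip: m(2))
  finally show "\<exists>y\<in>carrier (corner G e). y \<otimes>\<^bsub>corner G e\<^esub> x = \<one>\<^bsub>corner G e\<^esub>"
    using m(1) by (intro bexI[of _ "e \<otimes> m \<otimes> e"]) auto
next
  fix x y assume "x \<in> carrier (corner G e)" "y \<in> carrier (corner G e)"
  then show "x \<otimes>\<^bsub>corner G e\<^esub> y \<in> carrier (corner G e)"
    by (simp add: corner_carrier m_assoc) (simp flip: m_assoc)
qed (auto simp: corner_carrier m_assoc)

text \<open>The finite set \<open>Q\<close> represents the left ideals \<open>M r\<close> with \<open>r \<in> e M\<close>. If \<open>M e m = M q\<close>, then
  \<open>e m = h q\<close> for some \<open>h \<in> e M e\<close>, so that \<open>e m e = h (q e)\<close> and \<open>e m a e = h (q a e)\<close>. Once the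
  elements \<open>q e\<close> and \<open>q a e\<close> are put into a subgroup \<open>X\<close>, the condition \<open>e m e \<in> X\<close> is therefore
  constant along edges. It holds for \<open>m = 1\<close>, hence for all \<open>m\<close>.\<close>

lemma finitely_generated_corner_if_finitely_connected:
  assumes "finitely_connected G"
  shows "finitely_generated_group (corner G e)"
proof -
  interpret C: group "corner G e" by (rule group_corner)
  obtain A where A: "finite A" "A \<subseteq> carrier G" "cayley_connected G A"
    using assms by (auto simp: finitely_connected_def)
  define R where "R = {r \<in> carrier G. e \<otimes> r = r}"
  have "finite (principal_left_ideal G ` R)"
    by (rule finite_subset[OF image_mono finite_left]) (auto simp: R_def)
  then obtain Q where Q: "finite Q" "Q \<subseteq> R"
    "principal_left_ideal G ` R = principal_left_ideal G ` Q"
    using finite_subset_image[OF _ subset_refl] by metis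
  define T where "T = (\<lambda>q. q \<otimes> e) ` Q \<union> (\<lambda>(q, a). q \<otimes> a \<otimes> e) ` (Q \<times> A)"
  have T: "finite T"
    unfolding T_def using A(1) Q(1) by blast
  have T_carrier: "T \<subseteq> carrier (corner G e)"
  proof
    fix t assume "t \<in> T"
    then obtain q a where q: "q \<in> Q" and a: "a \<in> carrier G" "t = q \<otimes> a \<otimes> e"
      unfolding T_def using A(2) Q(2) by (force simp: R_def)
    then have "t = e \<otimes> (q \<otimes> a) \<otimes> e" "q \<otimes> a \<in> carrier G"
      using Q(2) by (auto simp: R_def simp flip: m_assoc)
    then show "t \<in> carrier (corner G e)"
      by auto
  qed
  define X where "X = generate (corner G e) T"
  have X: "subgroup X (corner G e)"
    unfolding X_def by (rule C.generate_is_subgroup[OF T_carrier])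
  have edge: "e \<otimes> (m \<otimes> a) \<otimes> e \<in> X \<longleftrightarrow> e \<otimes> m \<otimes> e \<in> X" if m: "m \<in> carrier G" and a: "a \<in> A" for m a
  proof -
    have a': "a \<in> carrier G"
      using a A(2) by blast
    have r: "e \<otimes> m \<in> R"
      using m by (simp add: R_def flip: m_assoc)
    then obtain q where q: "q \<in> Q" "principal_left_ideal G (e \<otimes> m) = principal_left_ideal G q"
      using Q(3) by (metis imageE imageI)
    have q': "q \<in> carrier G" "e \<otimes> q = q"
      using q(1) Q(2) by (auto simp: R_def)
    have "e \<otimes> m \<in> principal_left_ideal G (e \<otimes> m)"
      using m unfolding principal_left_ideal_def by (metis e_closed image_eqI l_one m_closed one_closed)
    then obtain s where s: "s \<in> carrier G" "e \<otimes> m = s \<otimes> q"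
      unfolding q(2) by (auto simp: principal_left_ideal_def)
    define h where "h = e \<otimes> s \<otimes> e"
    have h: "h \<in> carrier (corner G e)" "h \<in> carrier G"
      using s(1) by (auto simp: h_def)
    have "h \<otimes> q = e \<otimes> (s \<otimes> (e \<otimes> q))"
      using s(1) q'(1) by (simp only: h_def m_assoc m_closed e_closed)
    also have "\<dots> = (e \<otimes> e) \<otimes> m"
      using s q' m by (simp only: q'(2) m_assoc e_closed flip: s(2))
    finally have hq: "e \<otimes> m = h \<otimes> q"
      by simp
    have "e \<otimes> m \<otimes> e = h \<otimes> (q \<otimes> e)"
      using hq h(2) q'(1) by (simp add: m_assoc)
    moreover have "e \<otimes> (m \<otimes> a) \<otimes> e = (e \<otimes> m) \<otimes> (a \<otimes> e)"
      using m a' by (simp add: m_assoc)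
    then have "e \<otimes> (m \<otimes> a) \<otimes> e = h \<otimes> (q \<otimes> a \<otimes> e)"
      using hq h(2) q'(1) a' by (simp add: m_assoc)
    moreover have "q \<otimes> e \<in> X" "q \<otimes> a \<otimes> e \<in> X"
      using q(1) a by (auto simp: X_def T_def intro!: generate.incl)
    ultimately show ?thesis
      using C.mult_mem_subgroup_iff[OF X h(1)] by simp
  qed
  have "e \<otimes> \<one> \<otimes> e \<in> X"
    using generate.one[of "corner G e" T] by (simp add: X_def)
  with edge A(3)[unfolded cayley_connected_def, THEN spec[of _ "\<lambda>m. e \<otimes> m \<otimes> e \<in> X"]]
  have "e \<otimes> m \<otimes> e \<in> X" if "m \<in> carrier G" for m
    using that by blast
  then have "carrier (corner G e) \<subseteq> X"
    by (auto simp: corner_def)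
  then have "generate (corner G e) T = carrier (corner G e)"
    using C.generate_incl[OF T_carrier] unfolding X_def by blast
  then show ?thesis
    using T T_carrier unfolding finitely_generated_group_def by blast
qed

text \<open>From \<open>m\<close> there is an edge to \<open>m e\<close>. If \<open>q\<close> represents the right ideal \<open>m e M\<close>, then
  \<open>m e = q h\<close> with \<open>h \<in> e M e\<close>, so edges labelled by the generators of \<open>e M e\<close> lead from \<open>m e\<close>
  to \<open>q\<close>, and \<open>q\<close> is a neighbour of \<open>1\<close>.\<close>

lemma finitely_connected_if_finitely_generated_corner:
  assumes "finitely_generated_group (corner G e)"
  shows "finitely_connected G"
proof -
  interpret C: group "corner G e" by (rule group_corner)
  obtain T where T: "finite T" "T \<subseteq> carrier (corner G e)"
    "generate (corner G e) T = carrier (corner G e)"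
    using assms unfolding finitely_generated_group_def by blast
  define L where "L = {x \<in> carrier G. x \<otimes> e = x}"
  have "finite (principal_right_ideal G ` L)"
    by (rule finite_subset[OF image_mono finite_right]) (auto simp: L_def)
  then obtain Q where Q: "finite Q" "Q \<subseteq> L"
    "principal_right_ideal G ` L = principal_right_ideal G ` Q"
    using finite_subset_image[OF _ subset_refl] by metis
  define A where "A = insert e (T \<union> Q)"
  have "cayley_connected G A"
    unfolding cayley_connected_def
  proof (intro allI impI ballI)
    fix P m
    assume P: "P \<one> \<and> (\<forall>m\<in>carrier G. \<forall>a\<in>A. P (m \<otimes> a) \<longleftrightarrow> P m)" and m: "m \<in> carrier G"
    have edge: "P (x \<otimes> a) \<longleftrightarrow> P x" if "x \<in> carrier G" "a \<in> A" for x a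
      using P that by blast
    have coset: "P (x \<otimes> h) \<longleftrightarrow> P x" if "h \<in> generate (corner G e) T" "x \<in> carrier G" for h x
      using that
    proof (induction arbitrary: x)
      case one
      then show ?case
        by (simp add: edge A_def)
    next
      case (incl h)
      then show ?case
        by (simp add: edge A_def)
    next
      case (inv h)
      let ?i = "inv\<^bsub>corner G e\<^esub> h"
      have h: "h \<in> carrier (corner G e)"
        using inv T(2) by blast
      then have carr: "h \<in> carrier G" "?i \<in> carrier G"
        using C.inv_closed[OF h] by (simp_all add: corner_carrier)
      \<comment> \<open>the edge from \<open>x h\<inverse>\<close> labelled \<open>h\<close> ends in \<open>x e\<close>, a neighbour of \<open>x\<close>\<close>
      have "P (x \<otimes> ?i) \<longleftrightarrow> P (x \<otimes> ?i \<otimes> h)"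
        using inv carr by (simp add: edge A_def)
      also have "x \<otimes> ?i \<otimes> h = x \<otimes> e"
        using C.l_inv[OF h] inv(2) carr by (simp add: m_assoc)
      also have "P (x \<otimes> e) \<longleftrightarrow> P x"
        using inv(2) by (simp add: edge A_def)
      finally show ?case .
    next
      case (eng h1 h2)
      then have "h1 \<in> carrier G" "h2 \<in> carrier G"
        by (simp_all add: T(3) corner_carrier)
      with eng show ?case
        by (simp flip: m_assoc)
    qed
    have "m \<otimes> e \<in> L"
      using m by (simp add: L_def m_assoc)
    then obtain q where q: "q \<in> Q" "principal_right_ideal G (m \<otimes> e) = principal_right_ideal G q"
      using Q(3) by (metis imageE imageI)
    have q': "q \<in> carrier G" "q \<otimes> e = q"
      using q(1) Q(2) by (auto simp: L_def)
    have "m \<otimes> e \<in> principal_right_ideal G (m \<otimes> e)"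
      using m unfolding principal_right_ideal_def by (metis e_closed image_eqI r_one m_closed one_closed)
    then obtain s where s: "s \<in> carrier G" "m \<otimes> e = q \<otimes> s"
      unfolding q(2) by (auto simp: principal_right_ideal_def)
    have "q \<otimes> (e \<otimes> s \<otimes> e) = (q \<otimes> e) \<otimes> s \<otimes> e"
      using q'(1) s(1) by (simp only: m_assoc m_closed e_closed)
    also have "\<dots> = m \<otimes> (e \<otimes> e)"
      using m by (simp only: q'(2) m_assoc e_closed flip: s(2))
    finally have "m \<otimes> e = q \<otimes> (e \<otimes> s \<otimes> e)"
      by simp
    moreover have "P (q \<otimes> (e \<otimes> s \<otimes> e)) \<longleftrightarrow> P q"
      using s(1) q'(1) by (intro coset) (auto simp: T(3))
    moreover have "P (\<one> \<otimes> q) \<longleftrightarrow> P \<one>"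
      using q(1) by (intro edge) (auto simp: A_def)
    moreover have "P (m \<otimes> e) \<longleftrightarrow> P m"
      using m by (intro edge) (auto simp: A_def)
    ultimately show "P m"
      using P q'(1) by simp
  qed
  moreover have "finite A" "A \<subseteq> carrier G"
    using T(1,2) Q(1,2) by (auto simp: A_def L_def corner_carrier)
  ultimately show ?thesis
    by (auto simp: finitely_connected_def)
qed

lemma left_FP1_iff: "left_FP1 G \<longleftrightarrow> finitely_generated_group (corner G e)"
  using left_FP1_iff_finitely_connected finitely_generated_corner_if_finitely_connected
    finitely_connected_if_finitely_generated_corner by blast

lemma kernel_idempotent_opposite: "kernel_idempotent (opposite G) e"
proof -
  have "principal_left_ideal (opposite G) = principal_right_ideal G"
    "principal_right_ideal (opposite G) = principal_left_ideal G"
    by (auto simp: principal_left_ideal_def principal_right_ideal_def fun_eq_iff)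
  moreover have "\<exists>a\<in>carrier G. \<exists>b\<in>carrier G. e = b \<otimes> (x \<otimes> a)" if x: "x \<in> carrier G" for x
    using kernel[OF x] x by (metis m_assoc)
  ultimately show ?thesis
    using finite_left finite_right monoid_opposite
    by (simp add: kernel_idempotent_def kernel_idempotent_axioms_def)
qed

lemma right_FP1_iff: "right_FP1 G \<longleftrightarrow> finitely_generated_group (corner G e)"
proof -
  interpret C: group "corner G e" by (rule group_corner)
  have "carrier (corner (opposite G) e) = carrier (corner G e)"
    by (auto simp: corner_def) (metis m_assoc e_closed)+
  then have "corner (opposite G) e = opposite (corner G e)"
    by (simp add: corner_def opposite_def)
  then show ?thesis
    using kernel_idempotent.left_FP1_iff[OF kernel_idempotent_opposite]
      right_FP1_iff_left_FP1_opposite C.finitely_generated_group_opposite by simp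
qed

end

text \<open>A group is its own kernel, with idempotent \<open>1\<close>, and has only one principal left and one principal
  right ideal.\<close>

lemma group_FP1_iff:
  fixes G :: "'a monoid" (structure)
  assumes "group G"
  shows "left_FP1 G \<longleftrightarrow> finitely_generated_group G"
    and "right_FP1 G \<longleftrightarrow> finitely_generated_group G"
proof -
  interpret group G by (rule assms)
  have left: "principal_left_ideal G x = carrier G" if x: "x \<in> carrier G" for x
    unfolding principal_left_ideal_def
  proof (intro equalityI subsetI)
    fix y assume "y \<in> carrier G"
    then show "y \<in> (\<lambda>m. m \<otimes> x) ` carrier G"
      using x by (intro image_eqI[of _ _ "y \<otimes> inv x"]) (simp_all add: m_assoc)
  qed (use x in auto)
  have right: "principal_right_ideal G x = carrier G" if x: "x \<in> carrier G" for x
    using surj_const_mult[OF x] by (simp add: principal_right_ideal_def)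
  interpret kernel_idempotent G \<one>
  proof
    show "finite (principal_left_ideal G ` carrier G)"
      by (rule finite_subset[of _ "{carrier G}"]) (use left in auto)
    show "finite (principal_right_ideal G ` carrier G)"
      by (rule finite_subset[of _ "{carrier G}"]) (use right in auto)
    show "\<exists>a\<in>carrier G. \<exists>b\<in>carrier G. \<one> = a \<otimes> x \<otimes> b" if x: "x \<in> carrier G" for x
      using x by (intro bexI[of _ "inv x"] bexI[of _ \<one>]) simp_all
  qed simp_all
  have "carrier (corner G \<one>) = carrier G"
    by (auto simp: corner_carrier)
  then have "corner G \<one> = G"
    by (simp add: corner_def)
  then show "left_FP1 G \<longleftrightarrow> finitely_generated_group G"
    "right_FP1 G \<longleftrightarrow> finitely_generated_group G"
    using left_FP1_iff right_FP1_iff by simp_all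
qed

section \<open>Semigroups with finitely many one-sided ideals\<close>

text \<open>The embedding \<open>\<iota>\<close> stands for the identity map of a semigroup with identity, or for the inclusion of
  a semigroup into itself with an identity adjoined. In both cases \<open>M\<close> has at most one principal left
  ideal that is not the image of a left ideal of the semigroup, namely \<open>M 1\<close>, and likewise on the
  right; and \<open>\<iota>\<close> identifies \<open>e S e\<close> with \<open>e M e\<close>, because \<open>e 1 e = e e e\<close>.\<close>

lemma semigroup_monoid_FP1_iff:
  fixes M :: "'b monoid" (structure) and \<iota> :: "'a::semigroup_mult \<Rightarrow> 'b" and K :: "'a set"
  assumes "monoid M" and inj: "inj \<iota>" and hom: "\<And>x y. \<iota> (x * y) = \<iota> x \<otimes> \<iota> y"
    and carrier: "carrier M = insert \<one> (range \<iota>)"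
    and finite_left: "finite {I :: 'a set. left_ideal I}"
    and finite_right: "finite {I :: 'a set. right_ideal I}"
    and K: "minimal_ideal K" and e: "e * e = e" "e \<in> K"
  shows "group (local_monoid e)"
    and "left_FP1 M \<longleftrightarrow> finitely_generated_group (local_monoid e)"
    and "right_FP1 M \<longleftrightarrow> finitely_generated_group (local_monoid e)"
proof -
  interpret monoid M by (rule assms(1))
  have \<iota>_closed [simp]: "\<iota> x \<in> carrier M" for x
    by (simp add: carrier)
  have left: "principal_left_ideal M x \<in> insert (carrier M) ((`) \<iota> ` {I. left_ideal I})"
    if "x \<in> carrier M" for x
  proof (cases "x = \<one>")
    case True
    then show ?thesis
      by (simp add: principal_left_ideal_def)
  next
    case False
    with that carrier obtain s where s: "x = \<iota> s"
      by auto
    let ?I = "insert s (range (\<lambda>t. t * s))"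
    have "left_ideal ?I"
      unfolding left_ideal_def by (auto simp flip: mult.assoc)
    moreover have "principal_left_ideal M x = \<iota> ` ?I"
      by (simp add: principal_left_ideal_def s carrier image_image hom)
    ultimately show ?thesis
      by blast
  qed
  have right: "principal_right_ideal M x \<in> insert (carrier M) ((`) \<iota> ` {I. right_ideal I})"
    if "x \<in> carrier M" for x
  proof (cases "x = \<one>")
    case True
    then show ?thesis
      by (simp add: principal_right_ideal_def)
  next
    case False
    with that carrier obtain s where s: "x = \<iota> s"
      by auto
    let ?I = "insert s (range (\<lambda>t. s * t))"
    have "right_ideal ?I"
      unfolding right_ideal_def by (auto simp: mult.assoc)
    moreover have "principal_right_ideal M x = \<iota> ` ?I"
      by (simp add: principal_right_ideal_def s carrier image_image hom)
    ultimately show ?thesis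
      by blast
  qed
  have K_ideal: "s * x \<in> K" "x * s \<in> K" if "x \<in> K" for s x
    using K that by (auto simp: minimal_ideal_def two_sided_ideal_def left_ideal_def right_ideal_def)
  interpret kernel_idempotent M "\<iota> e"
  proof
    show "finite (principal_left_ideal M ` carrier M)"
      by (rule finite_subset[of _ "insert (carrier M) ((`) \<iota> ` {I. left_ideal I})"])
        (use left finite_left in auto)
    show "finite (principal_right_ideal M ` carrier M)"
      by (rule finite_subset[of _ "insert (carrier M) ((`) \<iota> ` {I. right_ideal I})"])
        (use right finite_right in auto)
    show "\<exists>a\<in>carrier M. \<exists>b\<in>carrier M. \<iota> e = a \<otimes> x \<otimes> b" if x: "x \<in> carrier M" for x
    proof (cases "x = \<one>")
      case True
      then show ?thesis
        by (intro bexI[of _ "\<iota> e"] bexI[of _ \<one>]) simp_all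
    next
      case False
      with x carrier obtain s where s: "x = \<iota> s"
        by auto
      \<comment> \<open>\<open>a\<close> ranges over \<open>K\<close>, which puts the ideal inside \<open>K\<close>; by minimality it is \<open>K\<close>\<close>
      define J where "J = {a * s * b | a b. a \<in> K}"
      have "two_sided_ideal J"
        unfolding two_sided_ideal_def left_ideal_def right_ideal_def
      proof (intro conjI allI ballI)
        show "J \<noteq> {}" "J \<noteq> {}"
          using e(2) by (auto simp: J_def)
        fix t y assume "y \<in> J"
        then obtain a b where ab: "y = a * s * b" "a \<in> K"
          by (auto simp: J_def)
        then have "t * y = (t * a) * s * b" "y * t = a * s * (b * t)"
          by (simp_all add: mult.assoc)
        then show "t * y \<in> J" "y * t \<in> J"
          using ab(2) K_ideal by (auto simp: J_def)
      qed
      moreover have "J \<subseteq> K"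
        by (auto simp: J_def intro: K_ideal)
      ultimately have "e \<in> J"
        using K e(2) by (auto simp: minimal_ideal_def)
      then obtain a b where "e = a * s * b"
        by (auto simp: J_def)
      then have "\<iota> e = \<iota> a \<otimes> x \<otimes> \<iota> b"
        by (simp add: s hom)
      then show ?thesis
        using \<iota>_closed by blast
    qed
  qed (simp_all add: e(1) flip: hom)
  have "carrier (corner M (\<iota> e)) = {\<iota> (e * s * e) | s. True}"
  proof (intro equalityI subsetI)
    fix x assume "x \<in> carrier (corner M (\<iota> e))"
    then obtain m where m: "m \<in> carrier M" "x = \<iota> e \<otimes> m \<otimes> \<iota> e"
      by (auto simp: corner_def)
    show "x \<in> {\<iota> (e * s * e) | s. True}"
    proof (cases "m = \<one>")
      case True
      then have "x = \<iota> (e * e * e)"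
        using m(2) by (simp add: e(1))
      then show ?thesis
        by blast
    next
      case False
      with m(1) carrier obtain s where "m = \<iota> s"
        by auto
      then have "x = \<iota> (e * s * e)"
        using m(2) by (simp add: hom)
      then show ?thesis
        by blast
    qed
  qed (auto simp: hom)
  then have corner: "carrier (corner M (\<iota> e)) = \<iota> ` carrier (local_monoid e)"
    by (auto simp: local_monoid_def)
  have iso: "the_inv \<iota> \<in> iso (corner M (\<iota> e)) (local_monoid e)"
  proof (rule isoI)
    show "the_inv \<iota> \<in> hom (corner M (\<iota> e)) (local_monoid e)"
      by (rule homI) (auto simp: corner the_inv_f_f[OF inj] local_monoid_def simp flip: hom)
    show "bij_betw (the_inv \<iota>) (carrier (corner M (\<iota> e))) (carrier (local_monoid e))"
      by (rule bij_betw_byWitness[where f' = \<iota>]) (auto simp: corner the_inv_f_f[OF inj])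
  qed
  from group.iso_imp_img_group[OF group_corner this] show group: "group (local_monoid e)"
    by (simp add: the_inv_f_f[OF inj] local_monoid_def)
  have "finitely_generated_group (corner M (\<iota> e)) \<longleftrightarrow> finitely_generated_group (local_monoid e)"
    using finitely_generated_group_surj[OF group_corner group] iso
      finitely_generated_group_surj[OF group group_corner] group.iso_set_sym[OF group_corner iso]
    by (auto simp: iso_def bij_betw_def)
  then show "left_FP1 M \<longleftrightarrow> finitely_generated_group (local_monoid e)"
    "right_FP1 M \<longleftrightarrow> finitely_generated_group (local_monoid e)"
    using left_FP1_iff right_FP1_iff by simp_all
qed

lemma monoid_adjoin_identity: "monoid (adjoin_identity TYPE('a::semigroup_mult))"
proof
  fix x y z :: "'a option"
  show "x \<otimes>\<^bsub>adjoin_identity TYPE('a)\<^esub> y \<otimes>\<^bsub>adjoin_identity TYPE('a)\<^esub> z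
    = x \<otimes>\<^bsub>adjoin_identity TYPE('a)\<^esub> (y \<otimes>\<^bsub>adjoin_identity TYPE('a)\<^esub> z)"
    by (cases x; cases y; cases z) (simp_all add: adjoin_identity_def mult.assoc)
  show "x \<otimes>\<^bsub>adjoin_identity TYPE('a)\<^esub> \<one>\<^bsub>adjoin_identity TYPE('a)\<^esub> = x"
    by (cases x) (simp_all add: adjoin_identity_def)
qed (simp_all add: adjoin_identity_def)

lemma monoid_monoid_with_identity:
  assumes "is_identity u" shows "monoid (monoid_with_identity u)"
  using assms by (intro monoidI) (auto simp: monoid_with_identity_def is_identity_def mult.assoc)

theorem corollary2:
  fixes K :: "'a::semigroup_mult set" and H :: "'a monoid"
  assumes "finite {I :: 'a set. left_ideal I}"
    and "finite {I :: 'a set. right_ideal I}"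
    and "minimal_ideal K"
    and "maximal_subgroup H" and "carrier H \<subseteq> K"
  shows "(semigroup_left_FP1 TYPE('a) \<longleftrightarrow> semigroup_right_FP1 TYPE('a))
       \<and> (semigroup_right_FP1 TYPE('a) \<longleftrightarrow> finitely_generated_group H)
       \<and> (finitely_generated_group H \<longleftrightarrow> left_FP1 H)
       \<and> (finitely_generated_group H \<longleftrightarrow> right_FP1 H)"
proof -
  obtain e where e: "e * e = e" "H = units_of (local_monoid e)"
    using assms(4) by (auto simp: maximal_subgroup_def)
  have "e \<in> carrier (local_monoid e)"
    by (auto simp: local_monoid_def e(1) intro!: exI[of _ e])
  then have "e \<in> Units (local_monoid e)"
    by (auto simp: Units_def local_monoid_def e(1) intro!: bexI[of _ e])
  then have "e \<in> K"
    using assms(5) e(2) by (auto simp: units_of_def)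
  note FP1_iff = semigroup_monoid_FP1_iff[OF _ _ _ _ assms(1-3) e(1) this]
  have adjoin: "group (local_monoid e)"
    "left_FP1 (adjoin_identity TYPE('a)) \<longleftrightarrow> finitely_generated_group (local_monoid e)"
    "right_FP1 (adjoin_identity TYPE('a)) \<longleftrightarrow> finitely_generated_group (local_monoid e)"
    by (rule FP1_iff[OF monoid_adjoin_identity, of Some];
        auto simp: adjoin_identity_def UNIV_option_conv)+
  have H: "H = local_monoid e"
    using group.Units_eq[OF adjoin(1)] by (simp add: e(2) units_of_def local_monoid_def)
  have "semigroup_left_FP1 TYPE('a) \<longleftrightarrow> finitely_generated_group H"
    "semigroup_right_FP1 TYPE('a) \<longleftrightarrow> finitely_generated_group H"
  proof -
    have identity: "left_FP1 (monoid_with_identity u) \<longleftrightarrow> finitely_generated_group H"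
      "right_FP1 (monoid_with_identity u) \<longleftrightarrow> finitely_generated_group H"
      if "is_identity u" for u :: 'a
      unfolding H
      by (rule FP1_iff[OF monoid_monoid_with_identity[OF that], of id];
          auto simp: monoid_with_identity_def)+
    have "is_identity (THE u::'a. is_identity u)" if u: "is_identity u" for u :: 'a
      by (rule theI[of _ u]) (use u in \<open>auto simp: is_identity_def, metis\<close>)
    then show "semigroup_left_FP1 TYPE('a) \<longleftrightarrow> finitely_generated_group H"
      "semigroup_right_FP1 TYPE('a) \<longleftrightarrow> finitely_generated_group H"
      unfolding semigroup_left_FP1_def semigroup_right_FP1_def
      using identity adjoin(2,3) H by auto
  qed
  moreover have "left_FP1 H \<longleftrightarrow> finitely_generated_group H"
    "right_FP1 H \<longleftrightarrow> finitely_generated_group H"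
    using group_FP1_iff adjoin(1) by (simp_all add: H)
  ultimately show ?thesis
    by blast
qed

end
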